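(* Let $W$ be a finite-dimensional real vector space and let $\Phi$ be a finite zonotopal complex in $W$. If $|\Phi|=\bigcup_{P\in\Phi}P$ is a polytope or a star-shaped ball, then $\Phi$ admits a zonotopal completion which is locally finite in $W$.
   Context: A zonotope is a polytope that is a Minkowski sum of finitely many line segments. A polyhedral complex is a (not necessarily finite) collection of polyhedra closed under faces such that non-disjoint members meet in a common face; it is zonotopal if every member is a zonotope. A zonotopal completion of $\Phi$ is a zonotopal complex containing $\Phi$ as a subcomplex whose union is $W$. A subset $D\subset W$ is a star-shaped ball if there is $w\in W$ such that every ray $\rho$ starting at $w$ meets the topological boundary $\partial D$ in a unique point $v\neq w$ and $D\cap\rho=\operatorname{Conv}(w,v)$. Locally finite in $W$: every point of $W$ has a neighborhood meeting only finitely many members. *)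

theory Defs
  imports "HOL-Analysis.Analysis" "HOL-Library.Set_Algebras"
begin

text \<open>
  A finite-dimensional real vector space \<open>W\<close> is rendered as a linear subspace of a Euclidean
  space, so that all dimensions, including \<open>0\<close>, are covered (\<open>W = UNIV\<close> is allowed).
  Topological notions are taken in the subspace topology \<open>top_of_set W\<close>, which is the canonical
  vector space topology of \<open>W\<close>.
\<close>

text \<open>
  The sum is the Minkowski sum of sets. Segments may degenerate to points, so points are
  zonotopes; the empty set is not a zonotope.
\<close>

definition zonotope :: "'a::euclidean_space set \<Rightarrow> bool" where
  "zonotope Z \<longleftrightarrow> polytope Z \<and>
     (\<exists>(n::nat) a b. Z = (\<Sum>i<n. closed_segment (a i) (b i)))"

text \<open>
  The library predicate \<open>face_of\<close> also admits the empty set as a face. Here faces are nonempty,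
  as is implicit in requiring a common face only for non-disjoint members.
\<close>

definition polyhedral_complex :: "'a::euclidean_space set set \<Rightarrow> bool" where
  "polyhedral_complex \<Phi> \<longleftrightarrow>
     (\<forall>P\<in>\<Phi>. polyhedron P) \<and>
     (\<forall>P\<in>\<Phi>. \<forall>F. F face_of P \<and> F \<noteq> {} \<longrightarrow> F \<in> \<Phi>) \<and>
     (\<forall>P\<in>\<Phi>. \<forall>Q\<in>\<Phi>. P \<inter> Q \<noteq> {} \<longrightarrow> (P \<inter> Q) face_of P \<and> (P \<inter> Q) face_of Q)"

definition zonotopal_complex :: "'a::euclidean_space set set \<Rightarrow> bool" where
  "zonotopal_complex \<Phi> \<longleftrightarrow> polyhedral_complex \<Phi> \<and> (\<forall>P\<in>\<Phi>. zonotope P)"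

definition subcomplex :: "'a::euclidean_space set set \<Rightarrow> 'a set set \<Rightarrow> bool" where
  "subcomplex \<Phi> \<Psi> \<longleftrightarrow> polyhedral_complex \<Phi> \<and> polyhedral_complex \<Psi> \<and> \<Phi> \<subseteq> \<Psi>"

definition zonotopal_completion ::
    "'a::euclidean_space set \<Rightarrow> 'a set set \<Rightarrow> 'a set set \<Rightarrow> bool" where
  "zonotopal_completion W \<Phi> \<Psi> \<longleftrightarrow> zonotopal_complex \<Psi> \<and> subcomplex \<Phi> \<Psi> \<and> \<Union>\<Psi> = W"

definition ray :: "'a::euclidean_space \<Rightarrow> 'a \<Rightarrow> 'a set" where
  "ray w u = {w + t *\<^sub>R u | t. 0 \<le> t}"

definition star_shaped_ball :: "'a::euclidean_space set \<Rightarrow> 'a set \<Rightarrow> bool" where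
  "star_shaped_ball W D \<longleftrightarrow> D \<subseteq> W \<and>
     (\<exists>w\<in>W. \<forall>u\<in>W - {0}. \<exists>v. v \<noteq> w \<and>
        ray w u \<inter> (top_of_set W frontier_of D) = {v} \<and>
        D \<inter> ray w u = convex hull {w, v})"

end

theory Submission
  imports Defs
begin

text \<open>
  If a set \<open>N\<close> of cells, closed under faces, consists of points at which the direction \<open>v\<close> leaves the
  union \<open>X\<close> of a zonotopal complex for good, then the prisms \<open>F + [j, j + 1] v\<close> over the cells \<open>F\<close> of \<open>N\<close>
  fit onto the complex. If \<open>X\<close> is a convex polyhedron, the points where \<open>v\<close> leaves \<open>X\<close> form such a union
  of cells, and the extruded complex fills \<open>X\<close> plus the ray spanned by \<open>v\<close>. Extruding a polytope
  successively along vectors that positively span \<open>W\<close> therefore fills \<open>W\<close>.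

  A star-shaped ball with centre \<open>w\<close> need not be convex, but its boundary cells \<open>G\<close> span a fan of
  cones with apex \<open>w\<close>, and it meets the cone over \<open>G\<close> in the polytope spanned by \<open>w\<close> and \<open>G\<close>. For
  each vertex \<open>g\<close> of a boundary cell one extrudes along \<open>g - w\<close>, but only inside those cones that contain
  this direction. Within each cone the situation remains convex, and in the end every cone is filled.
\<close>

section \<open>Extrusion of a complex\<close>

text \<open>Convex combinations of points of \<open>S\<close> stay in \<open>S\<close>, so
  injectivity on \<open>S\<close> alone makes \<open>f\<close> preserve and reflect open segments
  there. The map from \<open>(x, s)\<close> to \<open>x + s *\<^sub>R v\<close> is never injective
  globally, but it is on the products used below.\<close>

lemma face_of_linear_image_inj_on:
  assumes f: "linear f" and inj: "inj_on f S" and S: "convex S" and TS: "T \<subseteq> S"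
  shows "f ` T face_of f ` S \<longleftrightarrow> T face_of S"
proof -
  have mem: "f x \<in> f ` T \<longleftrightarrow> x \<in> T" if "x \<in> S" for x
    using inj_on_image_mem_iff[OF inj that TS] .
  have seg: "f x \<in> open_segment (f a) (f b) \<longleftrightarrow> x \<in> open_segment a b"
    if "a \<in> S" "b \<in> S" "x \<in> S" for a b x
  proof -
    have "f a = f b \<longleftrightarrow> a = b"
      using inj that by (meson inj_on_eq_iff)
    moreover have "f x = (1 - u) *\<^sub>R f a + u *\<^sub>R f b \<longleftrightarrow> x = (1 - u) *\<^sub>R a + u *\<^sub>R b"
      if u: "0 < u" "u < 1" for u
    proof -
      have "(1 - u) *\<^sub>R a + u *\<^sub>R b \<in> S"
        using S \<open>a \<in> S\<close> \<open>b \<in> S\<close> u by (simp add: convexD)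
      then have "f x = f ((1 - u) *\<^sub>R a + u *\<^sub>R b) \<longleftrightarrow> x = (1 - u) *\<^sub>R a + u *\<^sub>R b"
        using inj \<open>x \<in> S\<close> by (meson inj_on_eq_iff)
      then show ?thesis
        by (simp add: linear_add[OF f] linear_scale[OF f])
    qed
    ultimately show ?thesis
      unfolding in_segment by auto
  qed
  have conv: "convex (f ` T) \<longleftrightarrow> convex T"
  proof
    assume "convex T" then show "convex (f ` T)"
      by (rule convex_linear_image[OF f])
  next
    assume cT: "convex (f ` T)"
    show "convex T"
      unfolding convex_def
    proof (intro ballI allI impI)
      fix x y and u v :: real
      assume xy: "x \<in> T" "y \<in> T" "0 \<le> u" "0 \<le> v" "u + v = 1"
      have "u *\<^sub>R f x + v *\<^sub>R f y \<in> f ` T"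
        using cT xy by (simp add: convexD)
      then have "f (u *\<^sub>R x + v *\<^sub>R y) \<in> f ` T"
        by (simp add: linear_add[OF f] linear_scale[OF f])
      moreover have "u *\<^sub>R x + v *\<^sub>R y \<in> S"
        using S xy TS by (meson convexD subsetD)
      ultimately show "u *\<^sub>R x + v *\<^sub>R y \<in> T"
        using mem by blast
    qed
  qed
  have "(\<forall>a\<in>f ` S. \<forall>b\<in>f ` S. \<forall>x\<in>f ` T. x \<in> open_segment a b \<longrightarrow> a \<in> f ` T \<and> b \<in> f ` T)
     \<longleftrightarrow> (\<forall>a\<in>S. \<forall>b\<in>S. \<forall>x\<in>T. x \<in> open_segment a b \<longrightarrow> a \<in> T \<and> b \<in> T)"
    using seg mem TS by (simp add: subset_iff)
  then show ?thesis
    unfolding face_of_def using conv TS by blast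
qed

section \<open>Subdivision of the half-line into unit intervals\<close>

definition line_cells :: "real set set" where
  "line_cells = range (\<lambda>n. {real n}) \<union> range (\<lambda>n. {real n .. real n + 1})"

text \<open>A face with a point besides the two endpoints meets the relative interior and is
  therefore the whole interval; by convexity a face cannot consist of just the two
  endpoints.\<close>

lemma face_of_unit_interval:
  fixes a :: real
  assumes F: "F face_of {a .. a + 1}" and ne: "F \<noteq> {}"
  shows "F = {a} \<or> F = {a + 1} \<or> F = {a .. a + 1}"
proof (cases "F \<subseteq> {a, a + 1}")
  case True
  have "\<not> (a \<in> F \<and> a + 1 \<in> F)"
  proof
    assume "a \<in> F \<and> a + 1 \<in> F"
    moreover have "convex F" using F by (simp add: face_of_imp_convex)
    ultimately have "(1/2) *\<^sub>R a + (1/2) *\<^sub>R (a + 1) \<in> F"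
      by (intro convexD) auto
    with True show False by (auto simp: field_simps)
  qed
  with True ne show ?thesis by blast
next
  case False
  then obtain x where x: "x \<in> F" "x \<noteq> a" "x \<noteq> a + 1" by blast
  with F have "a \<le> x" "x \<le> a + 1" by (auto dest!: face_of_imp_subset)
  with x have "x \<in> rel_interior {a .. a + 1}"
    by (simp add: rel_interior_real_box)
  then have "{a .. a + 1} \<subseteq> F"
    using x F subset_of_face_of[OF F order_refl] by blast
  with F show ?thesis by (auto dest: face_of_imp_subset)
qed

lemma line_cells_faces:
  assumes "I \<in> line_cells" "J face_of I" "J \<noteq> {}"
  shows "J \<in> line_cells"
  using assms(1) unfolding line_cells_def
proof
  assume "I \<in> range (\<lambda>n. {real n})"
  with assms(2,3) show "J \<in> range (\<lambda>n. {real n}) \<union> range (\<lambda>n. {real n .. real n + 1})"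
    by (auto dest!: face_of_imp_subset)
next
  assume "I \<in> range (\<lambda>n. {real n .. real n + 1})"
  then obtain n where "I = {real n .. real n + 1}" by blast
  with face_of_unit_interval[of J "real n"] assms(2,3)
  have "J = {real n} \<or> J = {real (Suc n)} \<or> J = {real n .. real n + 1}"
    by (simp add: add.commute)
  then show "J \<in> range (\<lambda>n. {real n}) \<union> range (\<lambda>n. {real n .. real n + 1})"
    by blast
qed

lemma endpoint_faces_unit_interval:
  fixes a :: real
  shows "{a} face_of {a .. a + 1}" "{a + 1} face_of {a .. a + 1}"
  using segment_face_of[of a "a + 1"] extreme_point_of_segment[of _ a "a + 1"]
  by (auto simp: face_of_singleton closed_segment_eq_real_ivl)

lemma line_cells_Int:
  assumes "I \<in> line_cells" "J \<in> line_cells" 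
  shows "(I \<inter> J) face_of I"
proof -
  have pt: "{real m} face_of {real n .. real n + 1}" if "real m \<in> {real n .. real n + 1}" for m n
  proof -
    from that have "m = n \<or> real m = real n + 1" 
      by (auto simp flip: of_nat_Suc)
    then show ?thesis using endpoint_faces_unit_interval[of "real n"] by auto
  qed
  have iv: "({real n .. real n + 1} \<inter> {real m .. real m + 1}) face_of {real n .. real n + 1}" for m n
  proof -
    consider "m = n" | "m = n + 1" | "n = m + 1" | "m > n + 1" | "n > m + 1"
      by linarith
    then show ?thesis
    proof cases
      case 2
      then have "{real n .. real n + 1} \<inter> {real m .. real m + 1} = {real n + 1}" by auto
      then show ?thesis using endpoint_faces_unit_interval by metis
    next
      case 3
      then have "{real n .. real n + 1} \<inter> {real m .. real m + 1} = {real n}" by auto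
      then show ?thesis using endpoint_faces_unit_interval by metis
    qed (auto simp: face_of_refl)
  qed
  consider n where "I = {real n}" | n m where "I = {real n .. real n + 1}" "J = {real m}"
    | n m where "I = {real n .. real n + 1}" "J = {real m .. real m + 1}"
    using assms unfolding line_cells_def by blast
  then show ?thesis
  proof cases
    case 1
    then have "I \<inter> J = {} \<or> I \<inter> J = I" by blast
    moreover have "I face_of I" using 1 by (simp add: face_of_refl)
    ultimately show ?thesis by auto
  next
    case 2
    then have "I \<inter> J = {} \<or> I \<inter> J = {real m} \<and> real m \<in> I" by blast
    then show ?thesis using pt[of m n] 2(1) by (elim disjE conjE) simp_all
  next
    case 3 then show ?thesis using iv by blast
  qed
qed

lemma line_cells_nonneg: "I \<in> line_cells \<Longrightarrow> s \<in> I \<Longrightarrow> 0 \<le> s"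
  by (auto simp: line_cells_def)

lemma zero_line_cell: "{0} \<in> line_cells"
  by (auto simp: line_cells_def intro!: image_eqI[of _ _ 0])

lemma line_cells_cover:
  assumes "0 \<le> s" shows "\<exists>I\<in>line_cells. s \<in> I"
proof (rule bexI)
  show "s \<in> {real (nat \<lfloor>s\<rfloor>) .. real (nat \<lfloor>s\<rfloor>) + 1}"
    using assms by simp
  show "{real (nat \<lfloor>s\<rfloor>) .. real (nat \<lfloor>s\<rfloor>) + 1} \<in> line_cells"
    unfolding line_cells_def by blast
qed

lemma line_cells_segment: "I \<in> line_cells \<Longrightarrow> \<exists>a b. a \<le> b \<and> I = {a..b}"
  unfolding line_cells_def by (force intro: exI[of _ "real _"])

lemma finite_line_cells_le: "finite {I \<in> line_cells. \<exists>s\<in>I. s \<le> M}"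
proof (rule finite_subset)
  show "{I \<in> line_cells. \<exists>s\<in>I. s \<le> M} \<subseteq>
    (\<lambda>n. {real n}) ` {..nat \<lceil>M\<rceil>} \<union> (\<lambda>n. {real n .. real n + 1}) ` {..nat \<lceil>M\<rceil>}"
  proof
    fix I assume I: "I \<in> {I \<in> line_cells. \<exists>s\<in>I. s \<le> M}"
    have "n \<le> nat \<lceil>M\<rceil>" if "real n \<le> s" "s \<le> M" for n s
      using that by linarith
    with I show "I \<in> (\<lambda>n. {real n}) ` {..nat \<lceil>M\<rceil>} \<union> (\<lambda>n. {real n .. real n + 1}) ` {..nat \<lceil>M\<rceil>}"
      unfolding line_cells_def by auto
  qed
qed auto

section \<open>Prisms as linear images of products\<close>

definition prism :: "'a::euclidean_space set \<Rightarrow> 'a \<Rightarrow> real set \<Rightarrow> 'a set" where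
  "prism F v I = (\<lambda>(x, s). x + s *\<^sub>R v) ` (F \<times> I)"

lemma prism_iff: "z \<in> prism F v I \<longleftrightarrow> (\<exists>x\<in>F. \<exists>s\<in>I. z = x + s *\<^sub>R v)"
  unfolding prism_def by auto

lemma prism_zero [simp]: "prism F v {0} = F"
  by (auto simp: prism_iff)

lemma prism_empty [simp]: "prism {} v I = {}" "prism F v {} = {}"
  by (auto simp: prism_iff)

lemma linear_prism_map: "linear (\<lambda>(x, s). x + s *\<^sub>R (v::'a::euclidean_space))"
  by (rule linearI) (auto simp: algebra_simps)

lemma prism_set_plus: "a \<le> b \<Longrightarrow> prism F v {a..b} = F + closed_segment (a *\<^sub>R v) (b *\<^sub>R v)"
proof -
  assume "a \<le> b"
  have "closed_segment (a *\<^sub>R v) (b *\<^sub>R v) = (\<lambda>s. s *\<^sub>R v) ` closed_segment a b"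
    by (rule closed_segment_linear_image) (simp add: linear_scaleR_left)
  with \<open>a \<le> b\<close> show ?thesis
    by (force simp: prism_iff set_plus_def closed_segment_eq_real_ivl)
qed

text \<open>The prism is \<open>F\<close> plus one segment, so a representation of \<open>F\<close>
  gets one more summand, stored at index \<open>n\<close>. It remains a polytope because line cells
  are bounded.\<close>

lemma zonotope_prism:
  assumes "zonotope F" "I \<in> line_cells"
  shows "zonotope (prism F v I)"
proof -
  obtain a b where ab: "a \<le> b" "I = {a..b}" using line_cells_segment assms by blast
  obtain n p q where F: "F = (\<Sum>i<(n::nat). closed_segment (p i) (q i))" and pF: "polytope F"
    using assms(1) unfolding zonotope_def by blast
  have "polytope (prism F v I)"
    unfolding prism_def ab
    by (intro polytope_linear_image[OF linear_prism_map] polytope_Times pF polytope_interval[of a b, simplified])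
  moreover have "prism F v I = (\<Sum>i<Suc n. closed_segment ((p(n := a *\<^sub>R v)) i) ((q(n := b *\<^sub>R v)) i))"
    unfolding ab prism_set_plus[OF ab(1)] F by simp
  ultimately show ?thesis unfolding zonotope_def by blast
qed

text \<open>The ray must miss \<open>X\<close> at every positive parameter, not only at small ones.
  This makes the prism map injective and keeps prisms away from \<open>X\<close> except at their
  bases.\<close>

definition exit_points :: "'a::euclidean_space set \<Rightarrow> 'a \<Rightarrow> 'a set" where
  "exit_points X v = {x\<in>X. \<forall>s>0. x + s *\<^sub>R v \<notin> X}"

text \<open>If \<open>s < t\<close>, then \<open>x\<close> lies on the ray from \<open>y\<close> at
  the positive parameter \<open>t - s\<close>, although this ray has left \<open>X\<close> for
  good.\<close>

lemma exit_points_inj: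
  assumes "x \<in> exit_points X v" "y \<in> exit_points X v" "0 \<le> s" "0 \<le> t" "x + s *\<^sub>R v = y + t *\<^sub>R v"
  shows "x = y \<and> s = t"
proof -
  have *: "\<not> s < t" if "x \<in> exit_points X v" "y \<in> exit_points X v" "x + s *\<^sub>R v = y + t *\<^sub>R v" for x y s t
  proof
    assume "s < t"
    have "x = y + (t - s) *\<^sub>R v" using that by (simp add: algebra_simps)
    with that \<open>s < t\<close> show False unfolding exit_points_def by auto
  qed
  from *[of x y s t] *[of y x t s] assms have "s = t" by force
  with assms show ?thesis by simp
qed

lemma prism_inj_on:
  assumes "F \<subseteq> exit_points X v" "I \<in> line_cells"
  shows "inj_on (\<lambda>(x, s). x + s *\<^sub>R v) (F \<times> I)"
  using assms exit_points_inj[of _ X v] line_cells_nonneg[OF assms(2)]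
  by (auto simp: inj_on_def) (blast+)

text \<open>Over exit points the prism map is injective, so it carries the product face
  \<open>G \<times> J\<close> of \<open>F \<times> I\<close> to a face.\<close>

lemma prism_face:
  assumes "F \<subseteq> exit_points X v" "I \<in> line_cells" "convex F" "G face_of F" "J face_of I"
  shows "prism G v J face_of prism F v I"
proof -
  have GJ: "(G \<times> J) face_of (F \<times> I)" using assms by (simp add: face_of_Times)
  have "convex I" using line_cells_segment[OF assms(2)] by auto
  with assms(3) have "convex (F \<times> I)" by (rule convex_Times)
  then show ?thesis
    using face_of_linear_image_inj_on[OF linear_prism_map prism_inj_on[OF assms(1,2)], of "G \<times> J"]
      GJ face_of_imp_subset[OF GJ] unfolding prism_def by blast
qed

text \<open>A face of the prism pulls back to a face of \<open>F \<times> I\<close>, and faces of a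
  product of convex sets are products of faces.\<close>

lemma face_of_prism:
  assumes F: "F \<subseteq> exit_points X v" "I \<in> line_cells" "convex F" and P: "P face_of prism F v I" "P \<noteq> {}"
  obtains G J where "G face_of F" "J face_of I" "G \<noteq> {}" "J \<noteq> {}" "P = prism G v J"
proof -
  let ?f = "\<lambda>(x, s). x + s *\<^sub>R v"
  from P have "P \<subseteq> ?f ` (F \<times> I)" by (simp add: face_of_imp_subset prism_def)
  then obtain T where T: "T \<subseteq> F \<times> I" "P = ?f ` T"
    by (meson subset_imageE)
  have "convex I" using line_cells_segment[OF F(2)] by auto
  with F(3) have "convex (F \<times> I)" by (rule convex_Times)
  then have "T face_of (F \<times> I)"
    using face_of_linear_image_inj_on[OF linear_prism_map prism_inj_on[OF F(1,2)], of T]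
      P T unfolding prism_def by blast
  then obtain G J where "T = G \<times> J" "G face_of F" "J face_of I"
    unfolding face_of_Times_decomp by blast
  with T P(2) that show ?thesis unfolding prism_def by fastforce
qed

text \<open>A point above exit points determines its base point and its height, so a common point
  has the same coordinates in both prisms.\<close>

lemma prism_Int:
  assumes "F \<subseteq> exit_points X v" "G \<subseteq> exit_points X v" "I \<in> line_cells" "J \<in> line_cells"
  shows "prism F v I \<inter> prism G v J = prism (F \<inter> G) v (I \<inter> J)"
proof
  show "prism F v I \<inter> prism G v J \<subseteq> prism (F \<inter> G) v (I \<inter> J)"
  proof
    fix z assume "z \<in> prism F v I \<inter> prism G v J"
    then obtain x s y t where *: "x \<in> F" "s \<in> I" "z = x + s *\<^sub>R v" "y \<in> G" "t \<in> J" "z = y + t *\<^sub>R v"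
      by (auto simp: prism_iff)
    with assms exit_points_inj[of x X v y s t] line_cells_nonneg have "x = y" "s = t"
      by blast+
    with * show "z \<in> prism (F \<inter> G) v (I \<inter> J)" by (auto simp: prism_iff)
  qed
qed (auto simp: prism_def)

text \<open>Points at positive height lie outside \<open>X\<close>, so \<open>P\<close> can meet
  only the base of the prism. Both sides are empty if \<open>I\<close> does not contain
  \<open>0\<close>.\<close>

lemma prism_Int_old:
  assumes "F \<subseteq> exit_points X v" "I \<in> line_cells" "P \<subseteq> X"
  shows "P \<inter> prism F v I = prism (P \<inter> F) v ({0} \<inter> I)"
proof
  show "P \<inter> prism F v I \<subseteq> prism (P \<inter> F) v ({0} \<inter> I)"
  proof
    fix z assume z: "z \<in> P \<inter> prism F v I"
    then obtain x s where *: "x \<in> F" "s \<in> I" "z = x + s *\<^sub>R v"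
      by (auto simp: prism_iff)
    with assms z line_cells_nonneg[OF assms(2)] have "s = 0"
      unfolding exit_points_def by (cases "s = 0") force+
    with * z show "z \<in> prism (P \<inter> F) v ({0} \<inter> I)" by (auto simp: prism_iff)
  qed
qed (auto simp: prism_def)

section \<open>Attaching prisms to a complex\<close>

definition prisms :: "'a::euclidean_space set set \<Rightarrow> 'a \<Rightarrow> 'a set set" where
  "prisms N v = {prism F v I | F I. F \<in> N \<and> I \<in> line_cells}"

lemma prisms_iff: "P \<in> prisms N v \<longleftrightarrow> (\<exists>F\<in>N. \<exists>I\<in>line_cells. P = prism F v I)"
  unfolding prisms_def by blast

lemma Union_prisms: "\<Union>(prisms N v) = {x + s *\<^sub>R v | x s. x \<in> \<Union>N \<and> 0 \<le> s}"
proof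
  show "\<Union>(prisms N v) \<subseteq> {x + s *\<^sub>R v | x s. x \<in> \<Union>N \<and> 0 \<le> s}"
    using line_cells_nonneg by (fastforce simp: prisms_iff prism_iff)
  show "{x + s *\<^sub>R v | x s. x \<in> \<Union>N \<and> 0 \<le> s} \<subseteq> \<Union>(prisms N v)"
  proof
    fix z assume "z \<in> {x + s *\<^sub>R v | x s. x \<in> \<Union>N \<and> 0 \<le> s}"
    then obtain x s F where z: "z = x + s *\<^sub>R v" "F \<in> N" "x \<in> F" "0 \<le> s" by blast
    from line_cells_cover[OF z(4)] obtain I where "I \<in> line_cells" "s \<in> I" by blast
    with z show "z \<in> \<Union>(prisms N v)"
      by (intro UnionI[of "prism F v I"]) (auto simp: prisms_iff prism_iff)
  qed
qed

lemma polyhedral_complexD: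
  assumes "polyhedral_complex \<Psi>"
  shows "P \<in> \<Psi> \<Longrightarrow> polyhedron P" "P \<in> \<Psi> \<Longrightarrow> convex P"
    "P \<in> \<Psi> \<Longrightarrow> F face_of P \<Longrightarrow> F \<noteq> {} \<Longrightarrow> F \<in> \<Psi>"
    "P \<in> \<Psi> \<Longrightarrow> Q \<in> \<Psi> \<Longrightarrow> (P \<inter> Q) face_of P"
proof -
  from assms have
    1: "\<forall>P\<in>\<Psi>. polyhedron P" and 2: "\<forall>P\<in>\<Psi>. \<forall>F. F face_of P \<and> F \<noteq> {} \<longrightarrow> F \<in> \<Psi>"
    and 3: "\<forall>P\<in>\<Psi>. \<forall>Q\<in>\<Psi>. P \<inter> Q \<noteq> {} \<longrightarrow> (P \<inter> Q) face_of P \<and> (P \<inter> Q) face_of Q"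
    unfolding polyhedral_complex_def by auto
  show "P \<in> \<Psi> \<Longrightarrow> polyhedron P" "P \<in> \<Psi> \<Longrightarrow> convex P"
    using 1 polyhedron_imp_convex by auto
  show "P \<in> \<Psi> \<Longrightarrow> F face_of P \<Longrightarrow> F \<noteq> {} \<Longrightarrow> F \<in> \<Psi>" using 2 by blast
  show "P \<in> \<Psi> \<Longrightarrow> Q \<in> \<Psi> \<Longrightarrow> (P \<inter> Q) face_of P"
    using 3 by (cases "P \<inter> Q = {}") auto
qed

lemma prisms_faces:
  assumes \<Psi>: "polyhedral_complex \<Psi>" and N: "N \<subseteq> \<Psi>"
    and Nf: "\<And>F G. F \<in> N \<Longrightarrow> G face_of F \<Longrightarrow> G \<noteq> {} \<Longrightarrow> G \<in> N"
    and ex: "\<And>F. F \<in> N \<Longrightarrow> F \<subseteq> exit_points X v"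
    and P: "P \<in> prisms N v" "Q face_of P" "Q \<noteq> {}"
  shows "Q \<in> prisms N v"
proof -
  obtain F I where F: "F \<in> N" "I \<in> line_cells" "P = prism F v I"
    using P(1) by (auto simp: prisms_iff)
  have "convex F" using F N polyhedral_complexD(2)[OF \<Psi>] by blast
  with face_of_prism[OF ex[OF F(1)] F(2) this, of Q] F(3) P obtain G J where
    "G face_of F" "J face_of I" "G \<noteq> {}" "J \<noteq> {}" "Q = prism G v J" by blast
  then show ?thesis
    using Nf[OF F(1)] line_cells_faces[OF F(2)] by (auto simp: prisms_iff)
qed

text \<open>An old cell meets a prism at most in its base, hence in a face of a cell of
  \<open>N\<close>; two prisms meet in the prism over the intersections of their bases and of their
  line cells, which are faces again.\<close>

lemma zonotopal_complex_extrusion: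
  assumes \<Psi>: "zonotopal_complex \<Psi>" and N: "N \<subseteq> \<Psi>"
    and Nf: "\<And>F G. F \<in> N \<Longrightarrow> G face_of F \<Longrightarrow> G \<noteq> {} \<Longrightarrow> G \<in> N"
    and ex: "\<And>F. F \<in> N \<Longrightarrow> F \<subseteq> exit_points (\<Union>\<Psi>) v"
  shows "zonotopal_complex (\<Psi> \<union> prisms N v)"
proof -
  have pc: "polyhedral_complex \<Psi>" and zon: "\<And>P. P \<in> \<Psi> \<Longrightarrow> zonotope P"
    using \<Psi> unfolding zonotopal_complex_def by auto
  note pcD = polyhedral_complexD[OF pc]
  have zonN: "zonotope P" if "P \<in> \<Psi> \<union> prisms N v" for P
    using that
  proof
    assume "P \<in> prisms N v"
    then obtain F I where "F \<in> N" "I \<in> line_cells" "P = prism F v I" by (auto simp: prisms_iff)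
    moreover from this N zon have "zonotope F" by blast
    ultimately show ?thesis using zonotope_prism by blast
  qed (rule zon)
  then have poly: "polyhedron P" if "P \<in> \<Psi> \<union> prisms N v" for P
    using that unfolding zonotope_def by (blast intro: polytope_imp_polyhedron)
  have old_new: "(P \<inter> prism F v I) face_of P \<and> (P \<inter> prism F v I) face_of prism F v I"
    if *: "P \<in> \<Psi>" "F \<in> N" "I \<in> line_cells" for P F I
  proof (cases "0 \<in> I")
    case False
    have "P \<subseteq> \<Union>\<Psi>" using *(1) by blast
    from prism_Int_old[OF ex[OF *(2)] *(3) this] False show ?thesis by simp
  next
    case True
    have F: "F \<in> \<Psi>" using N * by blast
    have eq: "P \<inter> prism F v I = prism (P \<inter> F) v {0}"
      using prism_Int_old[OF ex[OF *(2)] *(3), of P] *(1) True by auto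
    have "{0} face_of I"
      using line_cells_Int[OF *(3) zero_line_cell] True by (simp add: Int_absorb1)
    moreover have "(P \<inter> F) face_of F" using pcD(4)[OF F *(1)] by (simp add: Int_commute)
    ultimately have "(P \<inter> prism F v I) face_of prism F v I"
      unfolding eq using prism_face[OF ex[OF *(2)] *(3)] pcD(2)[OF F] by blast
    then show ?thesis using eq pcD(4)[OF *(1) F] by simp
  qed
  have new_new: "(prism F v I \<inter> prism G v J) face_of prism F v I"
    if *: "F \<in> N" "I \<in> line_cells" "G \<in> N" "J \<in> line_cells" for F I G J
    using prism_face[OF ex[OF *(1)] *(2)] pcD(2,4) line_cells_Int[OF *(2,4)] N *
    by (simp add: prism_Int[OF ex[OF *(1)] ex[OF *(3)] *(2,4)] subset_iff)
  have "(P \<inter> Q) face_of P \<and> (P \<inter> Q) face_of Q" 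
    if "P \<in> \<Psi> \<union> prisms N v" "Q \<in> \<Psi> \<union> prisms N v" for P Q
    using that
  proof (elim UnE)
    assume "P \<in> \<Psi>" "Q \<in> \<Psi>" then show ?thesis using pcD(4) by (metis Int_commute)
  next
    assume "P \<in> \<Psi>" "Q \<in> prisms N v"
    then show ?thesis using old_new unfolding prisms_iff by blast
  next
    assume "P \<in> prisms N v" "Q \<in> \<Psi>"
    then show ?thesis using old_new unfolding prisms_iff by (metis Int_commute)
  next
    assume "P \<in> prisms N v" "Q \<in> prisms N v"
    then show ?thesis using new_new unfolding prisms_iff by (metis Int_commute)
  qed
  moreover have "F \<in> \<Psi> \<union> prisms N v" if "P \<in> \<Psi> \<union> prisms N v" "F face_of P" "F \<noteq> {}" for P F
    using that(1)
  proof
    assume "P \<in> \<Psi>" with pcD(3) that show ?thesis by blast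
  next
    assume "P \<in> prisms N v"
    with prisms_faces[OF pc N, where v = v and P = P and Q = F] Nf ex that show ?thesis by blast
  qed
  ultimately show ?thesis
    unfolding zonotopal_complex_def polyhedral_complex_def using zonN poly by simp
qed

section \<open>Polyhedra and rays\<close>

text \<open>From \<open>y\<close> the segment can be prolonged past the relative interior point
  \<open>x\<close> by some factor \<open>e > 1\<close> without leaving \<open>F\<close>; then
  \<open>z\<close> is its new end and \<open>u = 1 / e\<close>.\<close>

lemma rel_interior_segment_beyond:
  fixes F :: "'a::euclidean_space set"
  assumes "convex F" "x \<in> rel_interior F" "y \<in> F"
  obtains z u where "z \<in> F" "0 < u" "u < 1" "x = (1 - u) *\<^sub>R y + u *\<^sub>R z"
proof -
  obtain e where e: "e > 1" "(1 - e) *\<^sub>R y + e *\<^sub>R x \<in> F"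
    using convex_rel_interior_if2[OF assms(1,2)] assms(3) hull_inc[of y F affine] by blast
  show ?thesis
  proof (rule that[OF e(2)])
    show "0 < 1 / e" "1 / e < 1" using e by auto
    show "x = (1 - 1 / e) *\<^sub>R y + (1 / e) *\<^sub>R ((1 - e) *\<^sub>R y + e *\<^sub>R x)"
      using e(1) by (simp add: algebra_simps divide_simps flip: scaleR_add_left)
  qed
qed

text \<open>The smallest face containing \<open>x\<close> has \<open>x\<close> in its relative
  interior, since otherwise one of its facets through \<open>x\<close> would be a smaller
  face.\<close>

lemma polyhedron_carrier_face:
  fixes P :: "'a::euclidean_space set"
  assumes P: "polyhedron P" and x: "x \<in> P"
  obtains F where "F face_of P" "x \<in> rel_interior F"
proof -
  define F where "F = \<Inter>{F. F face_of P \<and> x \<in> F}"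
  have "P face_of P" using P by (intro face_of_refl polyhedron_imp_convex)
  then have ne: "{F. F face_of P \<and> x \<in> F} \<noteq> {}" using x by blast
  have F: "F face_of P" unfolding F_def by (rule face_of_Inter[OF ne]) auto
  have "x \<in> F" unfolding F_def by auto
  have "x \<in> rel_interior F"
  proof (rule ccontr)
    assume "x \<notin> rel_interior F"
    then obtain G where G: "G facet_of F" "x \<in> G"
      using rel_boundary_of_polyhedron[OF face_of_polyhedron_polyhedron[OF P F]] \<open>x \<in> F\<close> by blast
    have "G face_of P" using facet_of_imp_face_of[OF G(1)] F by (rule face_of_trans)
    with G(2) have "F \<subseteq> G" unfolding F_def by blast
    with G show False
      by (metis facet_of_imp_subset facet_of_irrefl subset_antisym)
  qed
  with F show ?thesis by (rule that)
qed

section \<open>Systems of linear inequalities\<close>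

definition halfspaces :: "('a::euclidean_space \<times> real) set \<Rightarrow> 'a set" where
  "halfspaces H = {x. \<forall>(a, b)\<in>H. a \<bullet> x \<le> b}"

text \<open>Zero normals are allowed, unlike in \<open>polyhedron\<close>, so that trivial
  inequalities produced by eliminating a direction need no separate treatment.\<close>

definition polyhedral :: "'a::euclidean_space set \<Rightarrow> bool" where
  "polyhedral P \<longleftrightarrow> (\<exists>H. finite H \<and> P = halfspaces H)"

lemma polyhedron_imp_polyhedral:
  assumes "polyhedron P" shows "polyhedral P"
proof -
  obtain F where F: "finite F" "P = \<Inter>F" "\<forall>h\<in>F. \<exists>a b. a \<noteq> 0 \<and> h = {x. a \<bullet> x \<le> b}"
    using assms unfolding polyhedron_def by blast
  then obtain a b where ab: "\<And>h. h \<in> F \<Longrightarrow> h = {x. a h \<bullet> x \<le> b h}" by metis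
  have "P = halfspaces ((\<lambda>h. (a h, b h)) ` F)"
    unfolding F(2) halfspaces_def using ab by auto
  with F(1) show ?thesis unfolding polyhedral_def by blast
qed

lemma polyhedral_convex: "polyhedral P \<Longrightarrow> convex P"
proof -
  assume "polyhedral P"
  then obtain H where "P = halfspaces H" unfolding polyhedral_def by blast
  then have "P = \<Inter>((\<lambda>(a, b). {x. a \<bullet> x \<le> b}) ` H)" unfolding halfspaces_def by auto
  then show ?thesis by (auto intro!: convex_Inter simp: convex_halfspace_le)
qed

lemma polyhedral_closed: "polyhedral P \<Longrightarrow> closed P"
proof -
  assume "polyhedral P"
  then obtain H where "P = halfspaces H" unfolding polyhedral_def by blast
  then have "P = \<Inter>((\<lambda>(a, b). {x. a \<bullet> x \<le> b}) ` H)" unfolding halfspaces_def by auto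
  then show ?thesis by (auto intro!: closed_Inter simp: closed_halfspace_le)
qed

text \<open>Fourier--Motzkin elimination of the coordinate \<open>s\<close>.\<close>

lemma polyhedral_plus_ray:
  fixes v :: "'a::euclidean_space"
  assumes "polyhedral P"
  shows "polyhedral {x + s *\<^sub>R v | x s. x \<in> P \<and> 0 \<le> s}"
proof -
  obtain H where H: "finite H" "P = halfspaces H" using assms unfolding polyhedral_def by blast
  define Hp where "Hp = {(a, b)\<in>H. a \<bullet> v > 0}"
  define Hn where "Hn = {(a, b)\<in>H. a \<bullet> v < 0}"
  define Hz where "Hz = {(a, b)\<in>H. a \<bullet> v \<le> 0}"
  \<comment> \<open>Inequalities with \<open>a \<bullet> v \<le> 0\<close> persist along the ray.
    The others are combined with those of \<open>Hn\<close> using the positive weights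
    \<open>- (c \<bullet> v)\<close> and \<open>a \<bullet> v\<close>, which cancel the component
    along \<open>v\<close>.\<close>
  define H' where "H' = Hz \<union> (\<lambda>((a, b), (c, d)). ((a \<bullet> v) *\<^sub>R c - (c \<bullet> v) *\<^sub>R a, (a \<bullet> v) * d - (c \<bullet> v) * b)) ` (Hp \<times> Hn)"
  have fin: "finite Hp" "finite H'"
    using H(1) unfolding H'_def Hp_def Hn_def Hz_def by (auto intro: finite_subset)
  have "z \<in> halfspaces H' \<longleftrightarrow> (\<exists>x s. z = x + s *\<^sub>R v \<and> x \<in> P \<and> 0 \<le> s)" for z
  proof
    assume z: "z \<in> halfspaces H'"
    have z0: "a \<bullet> z \<le> b" if "(a, b) \<in> H" "a \<bullet> v \<le> 0" for a b
      using z that unfolding halfspaces_def H'_def Hz_def by auto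
    have zpn: "(a \<bullet> z - b) / (a \<bullet> v) \<le> (c \<bullet> z - d) / (c \<bullet> v)"
      if *: "(a, b) \<in> H" "a \<bullet> v > 0" "(c, d) \<in> H" "c \<bullet> v < 0" for a b c d
    proof -
      have "((a \<bullet> v) *\<^sub>R c - (c \<bullet> v) *\<^sub>R a, (a \<bullet> v) * d - (c \<bullet> v) * b) \<in> H'"
        unfolding H'_def Hp_def Hn_def using *
        by (intro UnI2 image_eqI[of _ _ "((a, b), (c, d))"]) auto
      with z have "((a \<bullet> v) *\<^sub>R c - (c \<bullet> v) *\<^sub>R a) \<bullet> z \<le> (a \<bullet> v) * d - (c \<bullet> v) * b"
        unfolding halfspaces_def by blast
      then have "(a \<bullet> v) * (c \<bullet> z) - (c \<bullet> v) * (a \<bullet> z) \<le> (a \<bullet> v) * d - (c \<bullet> v) * b"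
        by (simp add: inner_diff_left)
      then show ?thesis using * by (simp add: divide_simps) (simp add: algebra_simps)
    qed
    \<comment> \<open>These are the lower bounds on a step back from \<open>z\<close> into
      \<open>P\<close>: zero, and one for each inequality in \<open>Hp\<close>. The largest of them
      respects the upper bounds from \<open>Hn\<close> by the combined inequalities.\<close>
    define S where "S = insert 0 ((\<lambda>(a, b). (a \<bullet> z - b) / (a \<bullet> v)) ` Hp)"
    define s where "s = Max S"
    have S: "finite S" "S \<noteq> {}" unfolding S_def using fin by auto
    have s0: "0 \<le> s" unfolding s_def using S by (intro Max_ge) (auto simp: S_def)
    have sp: "(a \<bullet> z - b) / (a \<bullet> v) \<le> s" if "(a, b) \<in> H" "a \<bullet> v > 0" for a b
      unfolding s_def using S(1) that by (intro Max_ge) (auto simp: S_def Hp_def image_iff)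
    have sin: "s \<in> S" unfolding s_def using S by (rule Max_in)
    have "a \<bullet> (z - s *\<^sub>R v) \<le> b" if ab: "(a, b) \<in> H" for a b
    proof -
      consider "a \<bullet> v > 0" | "a \<bullet> v = 0" | "a \<bullet> v < 0" by linarith
      then show ?thesis
      proof cases
        case 1
        with sp[OF ab] show ?thesis by (simp add: inner_diff_right divide_simps algebra_simps)
      next
        case 2
        with z0[OF ab] show ?thesis by (simp add: inner_diff_right)
      next
        case 3
        have "s \<le> (a \<bullet> z - b) / (a \<bullet> v)"
          using sin zpn[OF _ _ ab 3] z0[OF ab] 3 unfolding S_def Hp_def
          by (auto simp: divide_nonpos_neg)
        with 3 show ?thesis by (simp add: inner_diff_right divide_simps algebra_simps)
      qed
    qed
    then have "z - s *\<^sub>R v \<in> P" unfolding H(2) halfspaces_def by auto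
    with s0 show "\<exists>x s. z = x + s *\<^sub>R v \<and> x \<in> P \<and> 0 \<le> s"
      by (intro exI[of _ "z - s *\<^sub>R v"] exI[of _ s]) simp
  next
    assume "\<exists>x s. z = x + s *\<^sub>R v \<and> x \<in> P \<and> 0 \<le> s"
    then obtain x s where zx: "z = x + s *\<^sub>R v" "x \<in> P" "0 \<le> s" by blast
    have x: "a \<bullet> x \<le> b" if "(a, b) \<in> H" for a b using zx(2) that unfolding H(2) halfspaces_def by blast
    have "a \<bullet> z \<le> b" if "(a, b) \<in> H" "a \<bullet> v \<le> 0" for a b
      using x[OF that(1)] mult_nonneg_nonpos[OF zx(3) that(2)] unfolding zx(1) by (simp add: inner_add_right)
    moreover have "((a \<bullet> v) *\<^sub>R c - (c \<bullet> v) *\<^sub>R a) \<bullet> z \<le> (a \<bullet> v) * d - (c \<bullet> v) * b"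
      if *: "(a, b) \<in> H" "a \<bullet> v > 0" "(c, d) \<in> H" "c \<bullet> v < 0" for a b c d
    proof -
      have "(a \<bullet> v) * (c \<bullet> x) \<le> (a \<bullet> v) * d" "(c \<bullet> v) * b \<le> (c \<bullet> v) * (a \<bullet> x)"
        using x * by (auto intro: mult_left_mono mult_left_mono_neg)
      then show ?thesis unfolding zx(1) by (simp add: inner_diff_left inner_add_right algebra_simps)
    qed
    ultimately show "z \<in> halfspaces H'"
      unfolding halfspaces_def H'_def Hp_def Hn_def Hz_def by auto
  qed
  then have "{x + s *\<^sub>R v | x s. x \<in> P \<and> 0 \<le> s} = halfspaces H'" by auto
  with fin(2) show ?thesis unfolding polyhedral_def by blast
qed

text \<open>An exit point of a polyhedron makes tight some inequality that \<open>v\<close> violates.\<close>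

lemma exit_distance_bounded:
  fixes P :: "'a::euclidean_space set"
  assumes "polyhedral P"
  obtains M where "\<And>x s. x \<in> exit_points P v \<Longrightarrow> 0 \<le> s \<Longrightarrow> norm (x + s *\<^sub>R v) \<le> r \<Longrightarrow> s \<le> M"
proof -
  obtain H where H: "finite H" "P = halfspaces H" using assms unfolding polyhedral_def by blast
  define Hp where "Hp = {(a, b)\<in>H. a \<bullet> v > 0}"
  have fin: "finite Hp" using H(1) unfolding Hp_def by (auto intro: finite_subset)
  \<comment> \<open>The sum dominates each of its nonnegative terms, so it bounds \<open>s\<close>
    whichever inequality is tight at \<open>x\<close>.\<close>
  define M where "M = (\<Sum>(a, b)\<in>Hp. (norm a * \<bar>r\<bar> + \<bar>b\<bar>) / (a \<bullet> v))"
  have "s \<le> M" if x: "x \<in> exit_points P v" and s: "0 \<le> s" "norm (x + s *\<^sub>R v) \<le> r" for x s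
  proof -
    have xP: "a \<bullet> x \<le> b" if "(a, b) \<in> H" for a b
      using x that unfolding exit_points_def H(2) halfspaces_def by blast
    have "\<exists>(a, b)\<in>Hp. a \<bullet> x = b"
    proof (rule ccontr)
      assume no: "\<not> (\<exists>(a, b)\<in>Hp. a \<bullet> x = b)"
      \<comment> \<open>Were no inequality of \<open>Hp\<close> tight, the least of these positive
        step lengths would move \<open>x\<close> along \<open>v\<close> inside \<open>P\<close>. The
        element \<open>1\<close> keeps \<open>S\<close> nonempty.\<close>
      define S where "S = insert 1 ((\<lambda>(a, b). (b - a \<bullet> x) / (a \<bullet> v)) ` Hp)"
      have S: "finite S" "S \<noteq> {}" unfolding S_def using fin by auto
      have "b - a \<bullet> x > 0" if "(a, b) \<in> Hp" for a b
        using no that xP[of a b] unfolding Hp_def by fastforce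
      then have "\<forall>t\<in>S. 0 < t" unfolding S_def by (auto simp: Hp_def)
      then have pos: "0 < Min S" using S by simp
      have "a \<bullet> (x + Min S *\<^sub>R v) \<le> b" if ab: "(a, b) \<in> H" for a b
      proof (cases "a \<bullet> v > 0")
        case True
        then have "Min S \<le> (b - a \<bullet> x) / (a \<bullet> v)"
          using S(1) ab by (intro Min_le) (auto simp: S_def Hp_def image_iff)
        with True show ?thesis by (simp add: inner_add_right divide_simps algebra_simps)
      next
        case False
        with xP[OF ab] mult_nonneg_nonpos[of "Min S" "a \<bullet> v"] pos show ?thesis
          by (simp add: inner_add_right)
      qed
      then have "x + Min S *\<^sub>R v \<in> P" unfolding H(2) halfspaces_def by auto
      with pos x show False unfolding exit_points_def by blast
    qed
    then obtain a b where ab: "(a, b) \<in> Hp" "a \<bullet> x = b" by blast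
    then have av: "a \<bullet> v > 0" unfolding Hp_def by blast
    have "s * (a \<bullet> v) = a \<bullet> (x + s *\<^sub>R v) - b" using ab by (simp add: inner_add_right)
    also have "\<dots> \<le> norm a * norm (x + s *\<^sub>R v) + \<bar>b\<bar>"
      using norm_cauchy_schwarz[of a "x + s *\<^sub>R v"] by linarith
    also have "\<dots> \<le> norm a * \<bar>r\<bar> + \<bar>b\<bar>" using s(2) by (intro add_right_mono mult_left_mono) auto
    finally have "s \<le> (norm a * \<bar>r\<bar> + \<bar>b\<bar>) / (a \<bullet> v)" using av by (simp add: pos_le_divide_eq)
    also have "\<dots> = (\<lambda>(a, b). (norm a * \<bar>r\<bar> + \<bar>b\<bar>) / (a \<bullet> v)) (a, b)" by simp
    also have "\<dots> \<le> M" unfolding M_def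
      using fin by (intro member_le_sum[OF ab(1)]) (auto simp: Hp_def)
    finally show ?thesis .
  qed
  then show ?thesis by (rule that)
qed

section \<open>Successive extrusion inside a family of cones\<close>

text \<open>The point \<open>w\<close> is the common apex, but the members of \<open>K\<close> are
  kept as cones of directions at the origin, so that \<open>v \<in> C\<close> says directly that
  extrusion along \<open>v\<close> takes place in the cone.\<close>

locale cone_family =
  fixes W :: "'a::euclidean_space set" and w :: 'a and K :: "'a set set" and \<Phi> :: "'a set set"
  assumes W: "subspace W" and finite_K: "finite K"
    and K_add: "\<And>C x y. C \<in> K \<Longrightarrow> x \<in> C \<Longrightarrow> y \<in> C \<Longrightarrow> x + y \<in> C"
    and K_scale: "\<And>C x t. C \<in> K \<Longrightarrow> x \<in> C \<Longrightarrow> 0 \<le> t \<Longrightarrow> t *\<^sub>R x \<in> C"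
    \<comment> \<open>That is, \<open>C \<inter> C'\<close> is a face of \<open>C\<close>.\<close>
    and K_face: "\<And>C C' x y. C \<in> K \<Longrightarrow> C' \<in> K \<Longrightarrow> x \<in> C \<Longrightarrow> y \<in> C \<Longrightarrow> x + y \<in> C' \<Longrightarrow> x \<in> C' \<and> y \<in> C'"
begin

definition cone_at :: "'a set \<Rightarrow> 'a set" where
  "cone_at C = {x. x - w \<in> C}"

text \<open>
  \<open>E\<close> holds the cells from which later extrusions start: the boundary cells of \<open>\<Phi>\<close> (or all cells, in
  the convex case) and everything added so far. Cells of \<open>\<Phi>\<close> outside \<open>E\<close> may cross the cones.
\<close>

definition extendable :: "'a set set \<Rightarrow> bool" where
  "extendable E \<longleftrightarrow> zonotopal_complex (\<Phi> \<union> E) \<and> \<Union>(\<Phi> \<union> E) \<subseteq> W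
    \<and> (\<forall>F\<in>E. \<forall>G. G face_of F \<and> G \<noteq> {} \<longrightarrow> G \<in> E)
    \<and> (\<forall>F\<in>E. \<forall>C\<in>K. (F \<inter> cone_at C) face_of F)
    \<and> (\<forall>C\<in>K. polyhedral (\<Union>(\<Phi> \<union> E) \<inter> cone_at C))
    \<and> (\<forall>x\<in>\<Union>(\<Phi> \<union> E) - \<Union>E. \<forall>v\<in>W. \<exists>s>0. x + s *\<^sub>R v \<in> \<Union>(\<Phi> \<union> E))
    \<and> (\<forall>r. finite {F \<in> \<Phi> \<union> E. F \<inter> cball 0 r \<noteq> {}})"

lemma extendableD:
  assumes "extendable E"
  shows "zonotopal_complex (\<Phi> \<union> E)" "\<Union>(\<Phi> \<union> E) \<subseteq> W"
    and "\<And>F G. F \<in> E \<Longrightarrow> G face_of F \<Longrightarrow> G \<noteq> {} \<Longrightarrow> G \<in> E"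
    and "\<And>F C. F \<in> E \<Longrightarrow> C \<in> K \<Longrightarrow> (F \<inter> cone_at C) face_of F"
    and "\<And>C. C \<in> K \<Longrightarrow> polyhedral (\<Union>(\<Phi> \<union> E) \<inter> cone_at C)"
    and "\<And>x v. x \<in> \<Union>(\<Phi> \<union> E) \<Longrightarrow> x \<notin> \<Union>E \<Longrightarrow> v \<in> W \<Longrightarrow> \<exists>s>0. x + s *\<^sub>R v \<in> \<Union>(\<Phi> \<union> E)"
    and "\<And>r. finite {F \<in> \<Phi> \<union> E. F \<inter> cball 0 r \<noteq> {}}"
  using assms unfolding extendable_def by (blast+)

lemma cone_at_ray: "C \<in> K \<Longrightarrow> x \<in> cone_at C \<Longrightarrow> v \<in> C \<Longrightarrow> 0 \<le> s \<Longrightarrow> x + s *\<^sub>R v \<in> cone_at C"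
  using K_add[of C "x - w" "s *\<^sub>R v"] K_scale unfolding cone_at_def by (simp add: algebra_simps)

text \<open>The face property of the cones applies to the sum of \<open>x - w\<close> and
  \<open>s *\<^sub>R v\<close> inside \<open>C'\<close>. Hence a prism extruded inside
  \<open>C'\<close> can meet a cone without its direction only in its base.\<close>

lemma cone_at_back:
  assumes "C \<in> K" "C' \<in> K" "x \<in> cone_at C'" "v \<in> C'" "0 < s" "x + s *\<^sub>R v \<in> cone_at C"
  shows "x \<in> cone_at C" "v \<in> C"
proof -
  have "x - w \<in> C \<and> s *\<^sub>R v \<in> C"
    using assms K_scale[of C' v s] by (intro K_face[of C' C]) (auto simp: cone_at_def algebra_simps)
  then show "x \<in> cone_at C" "v \<in> C"
    using K_scale[of C "s *\<^sub>R v" "1 / s"] assms by (auto simp: cone_at_def)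
qed

text \<open>Requiring the cell to lie in a single cone that contains \<open>v\<close> confines the
  whole prism to that cone.\<close>

definition exposed_cells :: "'a set set \<Rightarrow> 'a \<Rightarrow> 'a set set" where
  "exposed_cells E v =
    {F \<in> E. F \<subseteq> exit_points (\<Union>(\<Phi> \<union> E)) v \<and> (\<exists>C\<in>K. v \<in> C \<and> F \<subseteq> cone_at C)}"

text \<open>Where the ray from \<open>x\<close> in direction \<open>v\<close> leaves the complex, convexity of the complex inside the
  cone makes the whole carrier of that point an exposed cell.\<close>

lemma ray_covered:
  assumes E: "extendable E" and v: "v \<in> W" "C \<in> K" "v \<in> C"
    and x: "x \<in> \<Union>(\<Phi> \<union> E)" "x \<in> cone_at C" and s: "0 \<le> s"
  shows "x + s *\<^sub>R v \<in> \<Union>(\<Phi> \<union> E) \<union> \<Union>(prisms (exposed_cells E v) v)"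
proof -
  note ED = extendableD[OF E]
  define X where "X = \<Union>(\<Phi> \<union> E)"
  define P where "P = X \<inter> cone_at C"
  have P: "convex P" "closed P"
    unfolding P_def X_def using ED(5)[OF v(2)] polyhedral_convex polyhedral_closed by auto
  \<comment> \<open>The ray is followed inside the convex set \<open>P\<close> up to its last point
    \<open>y\<close>; beyond \<open>y\<close> it is to be covered by prisms over the carrier of
    \<open>y\<close>.\<close>
  define T where "T = {0..s} \<inter> (\<lambda>t. x + t *\<^sub>R v) -` P"
  have "compact T" unfolding T_def
    by (intro compact_Int_closed compact_Icc closed_vimage P continuous_intros)
  moreover have "0 \<in> T" using x s unfolding T_def P_def X_def by auto
  ultimately obtain t where t: "t \<in> T" "\<And>q. q \<in> T \<Longrightarrow> q \<le> t"
    using compact_attains_sup[of T] by blast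
  define y where "y = x + t *\<^sub>R v"
  have ts: "0 \<le> t" "t \<le> s" and yP: "y \<in> P" using t(1) unfolding T_def y_def by auto
  show ?thesis
  proof (cases "t = s")
    case True
    with yP show ?thesis unfolding y_def P_def X_def by auto
  next
    case False
    with ts have "t < s" by simp
    \<comment> \<open>If the ray returned to \<open>P\<close>, convexity would place a further piece
      of length \<open>p\<close>, still within \<open>{0..s}\<close>, in \<open>P\<close>, against
      the maximality of \<open>t\<close>.\<close>
    have y_exit: "y + q *\<^sub>R v \<notin> P" if q: "q > 0" for q
    proof
      assume yq: "y + q *\<^sub>R v \<in> P"
      define p where "p = min q (s - t)"
      have p: "0 < p" "p \<le> q" "p \<le> s - t" using q \<open>t < s\<close> unfolding p_def by auto
      have "(1 - p / q) *\<^sub>R y + (p / q) *\<^sub>R (y + q *\<^sub>R v) \<in> P"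
        using P(1) yP yq p q by (intro convexD) auto
      moreover have "(1 - p / q) *\<^sub>R y + (p / q) *\<^sub>R (y + q *\<^sub>R v) = x + (t + p) *\<^sub>R v"
        using q unfolding y_def by (simp add: algebra_simps)
      ultimately have "t + p \<in> T" unfolding T_def using ts p by auto
      with t(2) p show False by fastforce
    qed
    have y_exit': "y + q *\<^sub>R v \<notin> X" if "q > 0" for q
      using y_exit[OF that] cone_at_ray[of C y v q] that v yP unfolding P_def by auto
    \<comment> \<open>A point of the union outside \<open>\<Union>E\<close> can be moved a little
      along any direction of \<open>W\<close> without leaving the union.\<close>
    have "y \<in> \<Union>E"
      using ED(6)[OF _ _ v(1), of y] y_exit' yP unfolding P_def X_def by blast
    then obtain F0 where F0: "F0 \<in> E" "y \<in> F0" by blast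
    have pc: "polyhedral_complex (\<Phi> \<union> E)" using ED(1) unfolding zonotopal_complex_def by blast
    have "polyhedron F0" using polyhedral_complexD(1)[OF pc, of F0] F0 by blast
    then obtain F where F: "F face_of F0" "y \<in> rel_interior F"
      using polyhedron_carrier_face F0(2) by blast
    have yF: "y \<in> F" using F rel_interior_subset by blast
    have FE: "F \<in> E" using ED(3)[OF F0(1) F(1)] yF by blast
    \<comment> \<open>The face of \<open>F\<close> cut out by the cone contains \<open>y\<close>, a
      relative interior point of \<open>F\<close>, and so is all of \<open>F\<close>.\<close>
    have "F \<subseteq> F \<inter> cone_at C"
      using subset_of_face_of[OF ED(4)[OF FE v(2)] order_refl] F(2) yF yP unfolding P_def by blast
    then have FP: "F \<subseteq> P" "F \<subseteq> cone_at C" using FE unfolding P_def X_def by auto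
    have "F \<subseteq> exit_points X v"
    proof
      fix z assume z: "z \<in> F"
      \<comment> \<open>With \<open>y\<close> strictly between \<open>z\<close> and
        \<open>z'\<close>, a return of the ray from \<open>z\<close> at height \<open>q\<close>
        would give, by convexity, a return of the ray from \<open>y\<close> at height
        \<open>(1 - u) * q\<close>.\<close>
      obtain z' u where u: "z' \<in> F" "0 < u" "u < 1" "y = (1 - u) *\<^sub>R z + u *\<^sub>R z'"
        using rel_interior_segment_beyond[OF face_of_imp_convex[OF F(1)] F(2) z] .
      have "z + q *\<^sub>R v \<notin> X" if q: "q > 0" for q
      proof
        assume "z + q *\<^sub>R v \<in> X"
        then have "z + q *\<^sub>R v \<in> P"
          using cone_at_ray[of C z v q] z q v FP(2) unfolding P_def by auto
        then have "(1 - u) *\<^sub>R (z + q *\<^sub>R v) + u *\<^sub>R z' \<in> P"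
          using P(1) FP(1) u by (intro convexD) auto
        moreover have "(1 - u) *\<^sub>R (z + q *\<^sub>R v) + u *\<^sub>R z' = y + ((1 - u) * q) *\<^sub>R v"
          using u(4) by (simp add: algebra_simps)
        ultimately show False using y_exit[of "(1 - u) * q"] u q by auto
      qed
      then show "z \<in> exit_points X v"
        using z FP(1) unfolding exit_points_def P_def by auto
    qed
    then have "F \<in> exposed_cells E v"
      unfolding exposed_cells_def X_def using FE FP v by blast
    moreover have "x + s *\<^sub>R v = y + (s - t) *\<^sub>R v" unfolding y_def by (simp add: algebra_simps)
    ultimately have "x + s *\<^sub>R v \<in> \<Union>(prisms (exposed_cells E v) v)"
      unfolding Union_prisms using yF ts by (smt (verit, best) UnionI mem_Collect_eq)
    then show ?thesis by blast
  qed
qed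

text \<open>In a cone containing \<open>v\<close> every ray along \<open>v\<close> gets filled by
  \<open>ray_covered\<close>, so the union there is swept along \<open>v\<close> and stays
  polyhedral. By \<open>cone_at_back\<close> nothing is added in the other cones.\<close>

lemma extendable_step:
  assumes E: "extendable E" and v: "v \<in> W"
  defines "E' \<equiv> E \<union> prisms (exposed_cells E v) v"
  shows "extendable E'"
    and "\<And>C. C \<in> K \<Longrightarrow> \<Union>(\<Phi> \<union> E') \<inter> cone_at C =
      (if v \<in> C then {x + s *\<^sub>R v | x s. x \<in> \<Union>(\<Phi> \<union> E) \<inter> cone_at C \<and> 0 \<le> s}
       else \<Union>(\<Phi> \<union> E) \<inter> cone_at C)"
proof -
  note ED = extendableD[OF E]
  define N where "N = exposed_cells E v"
  define X where "X = \<Union>(\<Phi> \<union> E)"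
  have pc: "polyhedral_complex (\<Phi> \<union> E)" using ED(1) unfolding zonotopal_complex_def by blast
  have NE: "N \<subseteq> E" and N_exit: "\<And>F. F \<in> N \<Longrightarrow> F \<subseteq> exit_points X v"
    and N_cone: "\<And>F. F \<in> N \<Longrightarrow> \<exists>C\<in>K. v \<in> C \<and> F \<subseteq> cone_at C"
    unfolding N_def exposed_cells_def X_def by auto
  have N_face: "G \<in> N" if "F \<in> N" "G face_of F" "G \<noteq> {}" for F G
    using that ED(3)[of F G] face_of_imp_subset[of G F] unfolding N_def exposed_cells_def
    by blast
  have eq: "\<Phi> \<union> E' = (\<Phi> \<union> E) \<union> prisms N v" unfolding E'_def N_def by blast
  have zc: "zonotopal_complex (\<Phi> \<union> E')"
    unfolding eq using ED(1) NE N_face N_exit unfolding X_def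
    by (intro zonotopal_complex_extrusion) auto
  have X': "\<Union>(\<Phi> \<union> E') = X \<union> {x + s *\<^sub>R v | x s. x \<in> \<Union>N \<and> 0 \<le> s}"
    unfolding eq X_def Union_Un_distrib Union_prisms by blast
  show cone_eq: "\<Union>(\<Phi> \<union> E') \<inter> cone_at C =
      (if v \<in> C then {x + s *\<^sub>R v | x s. x \<in> \<Union>(\<Phi> \<union> E) \<inter> cone_at C \<and> 0 \<le> s}
       else \<Union>(\<Phi> \<union> E) \<inter> cone_at C)" if C: "C \<in> K" for C
  proof -
    have reach: "x \<in> cone_at C \<and> v \<in> C" if "F \<in> N" "x \<in> F" "0 < s" "x + s *\<^sub>R v \<in> cone_at C" for x F s
    proof -
      obtain C' where "C' \<in> K" "v \<in> C'" "F \<subseteq> cone_at C'" using N_cone \<open>F \<in> N\<close> by blast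
      with cone_at_back[OF C, of C' x v s] that show ?thesis by blast
    qed
    have NX: "x \<in> X" if "F \<in> N" "x \<in> F" for F x
      using that NE unfolding X_def by blast
    show ?thesis
    proof (cases "v \<in> C")
      case True
      have "z \<in> {x + s *\<^sub>R v | x s. x \<in> X \<inter> cone_at C \<and> 0 \<le> s}" if z: "z \<in> \<Union>(\<Phi> \<union> E') \<inter> cone_at C" for z
      proof (cases "z \<in> X")
        case True with z show ?thesis by (intro CollectI exI[of _ z] exI[of _ 0]) auto
      next
        case False
        with z obtain x s F where z': "z = x + s *\<^sub>R v" "x \<in> F" "F \<in> N" "0 \<le> s" 
          unfolding X' by blast
        with False NX have "0 < s" by (cases "s = 0") auto
        with reach[of F x s] z' z NX show ?thesis by blast
      qed
      moreover have "x + s *\<^sub>R v \<in> \<Union>(\<Phi> \<union> E') \<inter> cone_at C" if "x \<in> X \<inter> cone_at C" "0 \<le> s" for x s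
        using ray_covered[OF E v C True, of x s] that cone_at_ray[OF C _ True, of x s]
        unfolding eq X_def N_def by auto
      ultimately have "\<Union>(\<Phi> \<union> E') \<inter> cone_at C = {x + s *\<^sub>R v | x s. x \<in> X \<inter> cone_at C \<and> 0 \<le> s}"
        by blast
      then show ?thesis unfolding X_def by (simp only: True if_True)
    next
      case False
      have "z \<in> X" if z: "z \<in> \<Union>(\<Phi> \<union> E') \<inter> cone_at C" for z
      proof (rule ccontr)
        assume "z \<notin> X"
        with z obtain x s F where z': "z = x + s *\<^sub>R v" "x \<in> F" "F \<in> N" "0 \<le> s" 
          unfolding X' by blast
        with \<open>z \<notin> X\<close> NX have "0 < s" by (cases "s = 0") auto
        with reach[of F x s] z' z False show False by blast
      qed
      then have "\<Union>(\<Phi> \<union> E') \<inter> cone_at C = X \<inter> cone_at C" unfolding X' by blast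
      then show ?thesis unfolding X_def by (simp only: False if_False)
    qed
  qed
  have sub: "\<Union>(\<Phi> \<union> E') \<subseteq> W"
  proof -
    have "x + s *\<^sub>R v \<in> W" if "x \<in> \<Union>N" for x s
    proof -
      have "x \<in> W" using that NE ED(2) by blast
      with v W show ?thesis by (intro subspace_add subspace_scale)
    qed
    then show ?thesis unfolding X' using ED(2) X_def by auto
  qed
  have faces: "G \<in> E'" if "F \<in> E'" "G face_of F" "G \<noteq> {}" for F G
    using that(1) unfolding E'_def
  proof
    assume "F \<in> E" with ED(3) that show "G \<in> E \<union> prisms (exposed_cells E v) v" by blast
  next
    assume "F \<in> prisms (exposed_cells E v) v"
    then have F: "F \<in> prisms N v" unfolding N_def .
    have "N \<subseteq> \<Phi> \<union> E" using NE by blast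
    from prisms_faces[OF pc this, where v = v, OF _ _ F that(2,3)] N_face N_exit
    have "G \<in> prisms N v" by blast
    then show "G \<in> E \<union> prisms (exposed_cells E v) v" unfolding N_def by blast
  qed
  have compat: "(P \<inter> cone_at C) face_of P" if P: "P \<in> E'" and C: "C \<in> K" for P C
  proof (cases "P \<in> E")
    case True with ED(4) C show ?thesis by blast
  next
    case False
    with P have "P \<in> prisms N v" unfolding E'_def N_def by blast
    then obtain F I where F: "F \<in> N" "I \<in> line_cells" "P = prism F v I"
      unfolding prisms_iff by blast
    obtain C' where C': "C' \<in> K" "v \<in> C'" "F \<subseteq> cone_at C'" using N_cone F(1) by blast
    have "F \<in> E" using F NE by blast
    then have FC: "(F \<inter> cone_at C) face_of F" and cF: "convex F"
      using ED(4) C polyhedral_complexD(2)[OF pc] by auto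
    have "{0} \<inter> I face_of I"
      using line_cells_Int[OF F(2) zero_line_cell] by (simp add: Int_commute)
    moreover have "I face_of I" using line_cells_segment[OF F(2)] by (auto intro: face_of_refl)
    \<comment> \<open>When \<open>v\<close> is not in \<open>C\<close>, only the base can meet the
      cone; the height factor then shrinks to \<open>{0} \<inter> I\<close>, a possibly empty face
      of \<open>I\<close>.\<close>
    moreover have "P \<inter> cone_at C = prism (F \<inter> cone_at C) v (if v \<in> C then I else {0} \<inter> I)"
    proof (intro set_eqI iffI)
      fix z assume z: "z \<in> P \<inter> cone_at C"
      then obtain x s where xs: "x \<in> F" "s \<in> I" "z = x + s *\<^sub>R v"
        unfolding F(3) by (auto simp: prism_iff)
      have "0 \<le> s" using line_cells_nonneg F(2) xs(2) by blast
      have "x \<in> cone_at C \<and> (s = 0 \<or> v \<in> C)"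
        using \<open>0 \<le> s\<close> cone_at_back[OF C C'(1) _ C'(2), of x s] C'(3) z xs by (cases "s = 0") auto
      then have "x \<in> F \<inter> cone_at C" "s \<in> (if v \<in> C then I else {0} \<inter> I)" using xs by auto
      then show "z \<in> prism (F \<inter> cone_at C) v (if v \<in> C then I else {0} \<inter> I)"
        using xs(3) unfolding prism_iff by blast
    next
      fix z assume "z \<in> prism (F \<inter> cone_at C) v (if v \<in> C then I else {0} \<inter> I)"
      then obtain x s where xs: "x \<in> F" "x \<in> cone_at C" "s \<in> (if v \<in> C then I else {0} \<inter> I)" "z = x + s *\<^sub>R v"
        unfolding prism_iff by blast
      then have "s \<in> I" and s: "s = 0 \<or> v \<in> C" by (auto split: if_splits)
      with xs have "z \<in> P" unfolding F(3) prism_iff by blast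
      moreover have "z \<in> cone_at C"
        using s xs cone_at_ray[OF C xs(2)] line_cells_nonneg[OF F(2) \<open>s \<in> I\<close>] by auto
      ultimately show "z \<in> P \<inter> cone_at C" by blast
    qed
    ultimately show ?thesis
      using prism_face[OF N_exit[OF F(1)] F(2) cF FC] unfolding F(3) by auto
  qed
  have poly: "polyhedral (\<Union>(\<Phi> \<union> E') \<inter> cone_at C)" if "C \<in> K" for C
    unfolding cone_eq[OF that]
    by (cases "v \<in> C") (simp_all only: if_True if_False ED(5)[OF that] polyhedral_plus_ray[OF ED(5)[OF that]])
  have inner: "\<exists>s>0. x + s *\<^sub>R u \<in> \<Union>(\<Phi> \<union> E')"
    if x: "x \<in> \<Union>(\<Phi> \<union> E') - \<Union>E'" "u \<in> W" for x u
  proof -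
    have "x \<in> \<Union>(\<Phi> \<union> E)" "x \<notin> \<Union>E" using x(1) unfolding E'_def by auto
    with ED(6) x(2) obtain s where "s > 0" "x + s *\<^sub>R u \<in> \<Union>(\<Phi> \<union> E)" by blast
    then show ?thesis unfolding E'_def by blast
  qed
  have fin: "finite {P \<in> \<Phi> \<union> E'. P \<inter> cball 0 r \<noteq> {}}" for r
  proof -
    have "\<exists>M. \<forall>x s. x \<in> exit_points (X \<inter> cone_at C) v \<longrightarrow> 0 \<le> s \<longrightarrow> norm (x + s *\<^sub>R v) \<le> r \<longrightarrow> s \<le> M"
      if "C \<in> K" for C
      using exit_distance_bounded[OF ED(5)[OF that], of v r] unfolding X_def by metis
    then obtain M where M: "\<And>C x s. C \<in> K \<Longrightarrow> x \<in> exit_points (X \<inter> cone_at C) v \<Longrightarrow> 0 \<le> s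
        \<Longrightarrow> norm (x + s *\<^sub>R v) \<le> r \<Longrightarrow> s \<le> M C" by metis
    \<comment> \<open>As \<open>K\<close> is finite, a single height \<open>b\<close> bounds all
      points of the new prisms in the ball of radius \<open>r\<close>.\<close>
    define b where "b = (\<Sum>C\<in>K. \<bar>M C\<bar>)"
    have bound: "s \<le> b" if "F \<in> N" "x \<in> F" "0 \<le> s" "norm (x + s *\<^sub>R v) \<le> r" for F x s
    proof -
      obtain C where C: "C \<in> K" "v \<in> C" "F \<subseteq> cone_at C" using N_cone \<open>F \<in> N\<close> by blast
      \<comment> \<open>Leaving the union means leaving its polyhedral part in the cone, to which
        the bound for polyhedra applies.\<close>
      have "x \<in> exit_points (X \<inter> cone_at C) v"
        using N_exit[OF that(1)] that(2) C(3) unfolding exit_points_def by blast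
      from M[OF C(1) this that(3,4)] have "s \<le> \<bar>M C\<bar>" by simp
      also have "\<dots> \<le> b" unfolding b_def using finite_K C(1) by (intro member_le_sum) auto
      finally show ?thesis .
    qed
    \<comment> \<open>A prism that meets the ball of radius \<open>r\<close> does so at height at
      most \<open>b\<close>, so its base meets the ball of radius \<open>R\<close>.\<close>
    define R where "R = r + b * norm v"
    have "{P \<in> prisms N v. P \<inter> cball 0 r \<noteq> {}} \<subseteq>
      (\<lambda>(F, I). prism F v I) ` ({F \<in> \<Phi> \<union> E. F \<inter> cball 0 R \<noteq> {}} \<times> {I \<in> line_cells. \<exists>s\<in>I. s \<le> b})"
    proof
      fix P assume "P \<in> {P \<in> prisms N v. P \<inter> cball 0 r \<noteq> {}}"
      then obtain z where "P \<in> prisms N v" "z \<in> P" "norm z \<le> r" by auto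
      moreover from this obtain F I where "F \<in> N" "I \<in> line_cells" "P = prism F v I"
        unfolding prisms_iff by blast
      moreover from calculation obtain x s where "x \<in> F" "s \<in> I" "z = x + s *\<^sub>R v"
        by (metis prism_iff)
      ultimately have *: "F \<in> N" "I \<in> line_cells" "P = prism F v I"
        "x \<in> F" "s \<in> I" "norm (x + s *\<^sub>R v) \<le> r" by auto
      have s: "0 \<le> s" "s \<le> b" using line_cells_nonneg bound * by blast+
      have "norm x = norm ((x + s *\<^sub>R v) - s *\<^sub>R v)" by simp
      also have "\<dots> \<le> norm (x + s *\<^sub>R v) + norm (s *\<^sub>R v)" by (rule norm_triangle_ineq4)
      also have "\<dots> \<le> R" unfolding R_def using * s by (auto intro!: add_mono mult_right_mono)
      finally have "x \<in> F \<inter> cball 0 R" using * by simp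
      then have "F \<in> {F \<in> \<Phi> \<union> E. F \<inter> cball 0 R \<noteq> {}}" using * NE by blast
      with * s show "P \<in> (\<lambda>(F, I). prism F v I) `
          ({F \<in> \<Phi> \<union> E. F \<inter> cball 0 R \<noteq> {}} \<times> {I \<in> line_cells. \<exists>s\<in>I. s \<le> b})" by blast
    qed
    then have "finite {P \<in> prisms N v. P \<inter> cball 0 r \<noteq> {}}"
      by (rule finite_subset) (intro finite_imageI finite_cartesian_product ED(7) finite_line_cells_le)
    moreover have "{P \<in> \<Phi> \<union> E'. P \<inter> cball 0 r \<noteq> {}} =
      {P \<in> \<Phi> \<union> E. P \<inter> cball 0 r \<noteq> {}} \<union> {P \<in> prisms N v. P \<inter> cball 0 r \<noteq> {}}"
      unfolding eq by blast
    ultimately show ?thesis using ED(7)[of r] by simp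
  qed
  show "extendable E'"
    unfolding extendable_def
    by (intro conjI ballI allI impI)
      (erule conjE | assumption | rule zc sub faces compat poly inner fin)+
qed

text \<open>Later extrusions do not spoil earlier ones: a new point \<open>y + t *\<^sub>R v\<close>
  is moved along an old direction \<open>u\<close> by first moving \<open>y\<close> along
  \<open>u\<close> and then sweeping along \<open>v\<close>.\<close>

lemma extendable_rays:
  assumes "finite V" "V \<subseteq> W" and E: "extendable E"
  shows "\<exists>E'. extendable E' \<and> E \<subseteq> E' \<and>
    (\<forall>C\<in>K. \<forall>v\<in>V \<inter> C. \<forall>x\<in>\<Union>(\<Phi> \<union> E') \<inter> cone_at C. \<forall>s\<ge>0. x + s *\<^sub>R v \<in> \<Union>(\<Phi> \<union> E'))"
  using assms(1,2)
proof (induction V rule: finite_induct)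
  case empty
  with E show ?case by blast
next
  case (insert v V)
  then obtain E1 where E1: "extendable E1" "E \<subseteq> E1"
    and rays: "\<And>C u x s. C \<in> K \<Longrightarrow> u \<in> V \<Longrightarrow> u \<in> C \<Longrightarrow> x \<in> \<Union>(\<Phi> \<union> E1) \<inter> cone_at C \<Longrightarrow> 0 \<le> s
      \<Longrightarrow> x + s *\<^sub>R u \<in> \<Union>(\<Phi> \<union> E1)" by (metis IntI insert_subset)
  define E2 where "E2 = E1 \<union> prisms (exposed_cells E1 v) v"
  have v: "v \<in> W" using insert.prems by blast
  note step = extendable_step[OF E1(1) v, folded E2_def]
  have "x + s *\<^sub>R u \<in> \<Union>(\<Phi> \<union> E2) \<inter> cone_at C"
    if C: "C \<in> K" and u: "u \<in> insert v V" "u \<in> C" and x: "x \<in> \<Union>(\<Phi> \<union> E2) \<inter> cone_at C" and s: "0 \<le> s" for C u x s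
  proof (cases "v \<in> C")
    case True
    have "x \<in> {x + s *\<^sub>R v | x s. x \<in> \<Union>(\<Phi> \<union> E1) \<inter> cone_at C \<and> 0 \<le> s}"
      using x unfolding step(2)[OF C] by (simp only: True if_True)
    then obtain y t where y: "x = y + t *\<^sub>R v" "y \<in> \<Union>(\<Phi> \<union> E1) \<inter> cone_at C" "0 \<le> t"
      by blast
    have inE2: "y + t *\<^sub>R v \<in> \<Union>(\<Phi> \<union> E2) \<inter> cone_at C"
      if "y \<in> \<Union>(\<Phi> \<union> E1) \<inter> cone_at C" "0 \<le> t" for y t
      using that unfolding step(2)[OF C] by (simp only: True if_True) blast
    show ?thesis
    proof (cases "u = v")
      case uv: True
      have "x + s *\<^sub>R u = y + (t + s) *\<^sub>R v" unfolding y(1) uv by (simp add: algebra_simps)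
      then show ?thesis using inE2[OF y(2), of "t + s"] y(3) s by simp
    next
      case False
      with u have "u \<in> V" by blast
      then have "y + s *\<^sub>R u \<in> \<Union>(\<Phi> \<union> E1) \<inter> cone_at C"
        using rays[OF C _ u(2) y(2) s] cone_at_ray[OF C _ u(2) s] y(2) by blast
      moreover have "x + s *\<^sub>R u = (y + s *\<^sub>R u) + t *\<^sub>R v" unfolding y(1) by (simp add: algebra_simps)
      ultimately show ?thesis using inE2[OF _ y(3)] by metis
    qed
  next
    case False
    with u have "u \<in> V" by blast
    then show ?thesis
      using rays[OF C _ u(2) _ s, of x] x False cone_at_ray[OF C _ u(2) s] unfolding step(2)[OF C] by simp
  qed
  moreover have "E \<subseteq> E2" using E1 unfolding E2_def by blast
  ultimately show ?case using step(1) by blast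
qed

text \<open>Once each cone is closed under its own directions in \<open>V\<close>, every nonnegative
  combination of them can be added to a covered point. Local finiteness comes from the finiteness of
  the cells meeting each ball.\<close>

lemma extendable_completion:
  assumes E: "extendable E" and \<Phi>: "polyhedral_complex \<Phi>"
    and V: "finite V" "V \<subseteq> W"
    and cover: "\<And>z. z \<in> W \<Longrightarrow> \<exists>C\<in>K. \<exists>x c. x \<in> \<Union>(\<Phi> \<union> E) \<inter> cone_at C \<and> (\<forall>v\<in>V \<inter> C. 0 \<le> c v)
      \<and> z = x + (\<Sum>v\<in>V \<inter> C. c v *\<^sub>R v)"
  shows "\<exists>\<Psi>. zonotopal_completion W \<Phi> \<Psi> \<and> locally_finite_in (top_of_set W) \<Psi>"
proof -
  obtain E' where E': "extendable E'" "E \<subseteq> E'"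
    and rays: "\<And>C u x s. C \<in> K \<Longrightarrow> u \<in> V \<Longrightarrow> u \<in> C \<Longrightarrow> x \<in> \<Union>(\<Phi> \<union> E') \<inter> cone_at C \<Longrightarrow> 0 \<le> s
      \<Longrightarrow> x + s *\<^sub>R u \<in> \<Union>(\<Phi> \<union> E')" using extendable_rays[OF V E] by blast
  note ED = extendableD[OF E'(1)]
  have "z \<in> \<Union>(\<Phi> \<union> E')" if z: "z \<in> W" for z
  proof -
    obtain C x c where C: "C \<in> K" and x: "x \<in> \<Union>(\<Phi> \<union> E) \<inter> cone_at C"
      and c: "\<forall>v\<in>V \<inter> C. 0 \<le> c v" and z: "z = x + (\<Sum>v\<in>V \<inter> C. c v *\<^sub>R v)" using cover[OF z] by blast
    \<comment> \<open>The summands are added one direction at a time, remaining in the cone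
      throughout.\<close>
    have "x + (\<Sum>v\<in>U. c v *\<^sub>R v) \<in> \<Union>(\<Phi> \<union> E') \<inter> cone_at C" if "finite U" "U \<subseteq> V \<inter> C" for U
      using that
    proof (induction U rule: finite_induct)
      case empty
      with x E' show ?case by auto
    next
      case (insert u U)
      then have IH: "x + (\<Sum>v\<in>U. c v *\<^sub>R v) \<in> \<Union>(\<Phi> \<union> E') \<inter> cone_at C" 
        and u: "u \<in> V" "u \<in> C" "0 \<le> c u" using c by auto
      have "x + (\<Sum>v\<in>insert u U. c v *\<^sub>R v) = (x + (\<Sum>v\<in>U. c v *\<^sub>R v)) + c u *\<^sub>R u"
        using insert by (simp add: algebra_simps)
      moreover have "(x + (\<Sum>v\<in>U. c v *\<^sub>R v)) + c u *\<^sub>R u \<in> \<Union>(\<Phi> \<union> E') \<inter> cone_at C"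
        by (rule IntI[OF rays[OF C u(1,2) IH u(3)] cone_at_ray[OF C IntD2[OF IH] u(2,3)]])
      ultimately show ?case by metis
    qed
    from this[of "V \<inter> C"] V(1) show ?thesis unfolding z by simp
  qed
  then have U: "\<Union>(\<Phi> \<union> E') = W" using ED(2) by blast
  have "locally_finite_in (top_of_set W) (\<Phi> \<union> E')"
    unfolding locally_finite_in_def
  proof (intro conjI ballI)
    show "\<Union>(\<Phi> \<union> E') \<subseteq> topspace (top_of_set W)" using U by simp
    fix x assume "x \<in> topspace (top_of_set W)"
    then have "x \<in> W" by simp
    have "finite {F \<in> \<Phi> \<union> E'. F \<inter> (W \<inter> ball x 1) \<noteq> {}}"
    proof (rule finite_subset[OF _ ED(7)])
      have "norm y \<le> norm x + 1" if "dist x y < 1" for y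
        using that norm_triangle_ineq2[of y x] by (simp add: dist_norm norm_minus_commute)
      then show "{F \<in> \<Phi> \<union> E'. F \<inter> (W \<inter> ball x 1) \<noteq> {}} \<subseteq> {F \<in> \<Phi> \<union> E'. F \<inter> cball 0 (norm x + 1) \<noteq> {}}"
        by fastforce
    qed
    then show "\<exists>V. openin (top_of_set W) V \<and> x \<in> V \<and> finite {U \<in> \<Phi> \<union> E'. U \<inter> V \<noteq> {}}"
      using \<open>x \<in> W\<close> by (intro exI[of _ "W \<inter> ball x 1"]) auto
  qed
  moreover have "zonotopal_completion W \<Phi> (\<Phi> \<union> E')"
    using ED(1) \<Phi> U unfolding zonotopal_completion_def subcomplex_def zonotopal_complex_def by blast
  ultimately show ?thesis by blast
qed

end

section \<open>Polytopes and star-shaped balls\<close>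

lemma zonotope_nonempty:
  fixes Z :: "'a::euclidean_space set"
  assumes "zonotope Z" shows "Z \<noteq> {}"
proof -
  have "(\<Sum>i<n. closed_segment (a i) (b i)) \<noteq> {}" for n :: nat and a b :: "nat \<Rightarrow> 'a"
  proof (induction n)
    case (Suc n) then show ?case by (auto simp: set_plus_def)
  qed (simp add: set_zero)
  with assms show ?thesis unfolding zonotope_def by blast
qed

text \<open>This is the complex from which extrusion starts when \<open>\<Phi>\<close> is
  empty.\<close>

lemma zonotopal_complex_origin: "zonotopal_complex {{0 :: 'a::euclidean_space}}"
proof -
  have "zonotope {0::'a}"
    unfolding zonotope_def by (auto simp: polytope_sing set_zero intro!: exI[of _ "0::nat"])
  moreover have "polyhedral_complex {{0::'a}}"
    unfolding polyhedral_complex_def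
    by (auto simp: polytope_imp_polyhedron polytope_sing face_of_refl dest: face_of_imp_subset)
  ultimately show ?thesis unfolding zonotopal_complex_def by blast
qed

text \<open>A single cone, \<open>W\<close> itself, suffices, with all cells of
  \<open>\<Phi>\<close> as starting cells; the condition on points outside \<open>\<Union>E\<close>
  is then vacuous.\<close>

lemma zonotopal_completion_nonempty_polytope:
  fixes W :: "'a::euclidean_space set"
  assumes W: "subspace W" and fin: "finite \<Phi>" and zc: "zonotopal_complex \<Phi>" and sub: "\<Union>\<Phi> \<subseteq> W"
    and poly: "polytope (\<Union>\<Phi>)" and ne: "\<Union>\<Phi> \<noteq> {}"
  shows "\<exists>\<Psi>. zonotopal_completion W \<Phi> \<Psi> \<and> locally_finite_in (top_of_set W) \<Psi>"
proof -
  interpret cone_family W 0 "{W}" \<Phi>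
    by unfold_locales (use W in \<open>auto simp: subspace_add subspace_scale\<close>)
  have cone_at: "cone_at W = W" unfolding cone_at_def by simp
  have pc: "polyhedral_complex \<Phi>" using zc unfolding zonotopal_complex_def by blast
  have ext: "extendable \<Phi>"
    unfolding extendable_def
  proof (intro conjI)
    show "\<forall>F\<in>\<Phi>. \<forall>C\<in>{W}. (F \<inter> cone_at C) face_of F"
    proof (intro ballI)
      fix F C assume F: "F \<in> \<Phi>" "C \<in> {W}"
      then have "F \<inter> cone_at C = F" using sub cone_at by auto
      then show "(F \<inter> cone_at C) face_of F" using polyhedral_complexD(2)[OF pc F(1)] by (simp add: face_of_refl)
    qed
    have "\<Union>(\<Phi> \<union> \<Phi>) \<inter> W = \<Union>\<Phi>" using sub by auto
    then show "\<forall>C\<in>{W}. polyhedral (\<Union>(\<Phi> \<union> \<Phi>) \<inter> cone_at C)"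
      using polyhedron_imp_polyhedral[OF polytope_imp_polyhedron[OF poly]] cone_at by simp
  qed (use zc sub fin polyhedral_complexD(3)[OF pc] in auto)
  obtain B where B: "B \<subseteq> W" "finite B" "W \<subseteq> span B"
    by (metis basis_exists finiteI_independent)
  \<comment> \<open>A spanning set together with its negatives spans \<open>W\<close>
    positively.\<close>
  define V where "V = B \<union> uminus ` B"
  have V: "finite V" "V \<subseteq> W" unfolding V_def using B W by (auto simp: subspace_neg)
  obtain x where x: "x \<in> \<Union>\<Phi>" using ne by blast
  show ?thesis
  proof (rule extendable_completion[OF ext pc V])
    fix z assume "z \<in> W"
    then have "z - x \<in> span B" using x sub B(3) W by (auto intro!: subspace_diff)
    then obtain u where u: "z - x = (\<Sum>b\<in>B. u b *\<^sub>R b)"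
      using span_finite[OF B(2)] by auto
    \<comment> \<open>Positive parts of the coefficients go to \<open>B\<close>, negative parts to
      the negatives. Adding \<open>p\<close> and \<open>q\<close> stays correct even for a vector
      lying in both sets.\<close>
    define p where "p v = (if v \<in> B then max (u v) 0 else 0)" for v
    define q where "q v = (if - v \<in> B then max (- u (- v)) 0 else 0)" for v
    have "(\<Sum>v\<in>V. p v *\<^sub>R v) = (\<Sum>b\<in>B. max (u b) 0 *\<^sub>R b)"
      using V by (intro sum.mono_neutral_cong_right) (auto simp: p_def V_def)
    moreover have "v \<in> uminus ` B" if "- v \<in> B" for v
      using that by (rule rev_image_eqI) simp
    then have "(\<Sum>v\<in>V. q v *\<^sub>R v) = (\<Sum>b\<in>uminus ` B. q b *\<^sub>R b)"
      using V by (intro sum.mono_neutral_right) (auto simp: q_def V_def)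
    moreover have "\<dots> = (\<Sum>b\<in>B. max (- u b) 0 *\<^sub>R (- b))"
      by (subst sum.reindex) (auto simp: q_def intro!: sum.cong)
    ultimately have "(\<Sum>v\<in>V. (p v + q v) *\<^sub>R v) = (\<Sum>b\<in>B. max (u b) 0 *\<^sub>R b + max (- u b) 0 *\<^sub>R (- b))"
      by (simp add: scaleR_add_left sum.distrib del: scaleR_minus_right)
    also have "\<dots> = (\<Sum>b\<in>B. u b *\<^sub>R b)"
      by (intro sum.cong) (auto simp: max_def)
    finally have "z = x + (\<Sum>v\<in>V \<inter> W. (p v + q v) *\<^sub>R v)"
      using u V(2) by (simp add: Int_absorb2 algebra_simps)
    moreover have "\<forall>v\<in>V \<inter> W. 0 \<le> p v + q v" unfolding p_def q_def by auto
    moreover have "x \<in> \<Union>(\<Phi> \<union> \<Phi>) \<inter> cone_at W" using x sub cone_at by auto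
    ultimately show "\<exists>C\<in>{W}. \<exists>x c. x \<in> \<Union>(\<Phi> \<union> \<Phi>) \<inter> cone_at C \<and> (\<forall>v\<in>V \<inter> C. 0 \<le> c v)
      \<and> z = x + (\<Sum>v\<in>V \<inter> C. c v *\<^sub>R v)"
      by (intro bexI[of _ W] exI[of _ x] exI[of _ "\<lambda>v. p v + q v"]) simp_all
  qed
qed

text \<open>An empty union forces \<open>\<Phi> = {}\<close>, as zonotopes are nonempty, and then a
  completion of \<open>{{0}}\<close> serves.\<close>

lemma zonotopal_completion_polytope:
  fixes W :: "'a::euclidean_space set"
  assumes W: "subspace W" and fin: "finite \<Phi>" and zc: "zonotopal_complex \<Phi>" and sub: "\<Union>\<Phi> \<subseteq> W"
    and poly: "polytope (\<Union>\<Phi>)"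
  shows "\<exists>\<Psi>. zonotopal_completion W \<Phi> \<Psi> \<and> locally_finite_in (top_of_set W) \<Psi>"
proof (cases "\<Union>\<Phi> = {}")
  case False
  with zonotopal_completion_nonempty_polytope assms show ?thesis by blast
next
  case True
  then have "\<Phi> = {}"
    using zc zonotope_nonempty unfolding zonotopal_complex_def by blast
  obtain \<Psi> where "zonotopal_completion W {{0}} \<Psi>" "locally_finite_in (top_of_set W) \<Psi>"
    using zonotopal_completion_nonempty_polytope[OF W _ zonotopal_complex_origin]
      subspace_0[OF W] polytope_sing by auto
  then show ?thesis
    unfolding zonotopal_completion_def subcomplex_def \<open>\<Phi> = {}\<close>
    by (intro exI[of _ \<Psi>]) (simp add: polyhedral_complex_def)
qed

text \<open>All cells near a point of \<open>rel_interior F\<close> contain \<open>F\<close>, so the union looks the same near any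
  two such points.\<close>

lemma interior_point_of_carrier:
  fixes W :: "'a::euclidean_space set"
  assumes W: "subspace W" and fin: "finite \<Phi>" and pc: "polyhedral_complex \<Phi>" and sub: "\<Union>\<Phi> \<subseteq> W"
    and F: "F \<in> \<Phi>" "x \<in> rel_interior F" and y: "y \<in> F" and e: "0 < e" "ball y e \<inter> W \<subseteq> \<Union>\<Phi>"
  shows "\<exists>r>0. ball x r \<inter> W \<subseteq> \<Union>\<Phi>"
proof -
  have cF: "convex F" using polyhedral_complexD(2)[OF pc F(1)] .
  \<comment> \<open>Moving \<open>y\<close> towards \<open>x\<close> by this fraction puts it in the
    relative interior of \<open>F\<close> and at distance at most \<open>e / 2\<close> from
    \<open>y\<close>. The summand \<open>1\<close> keeps the denominator positive.\<close>
  define t where "t = min 1 (e / (2 * (norm (y - x) + 1)))"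
  have n: "norm (y - x) + 1 > 0" by (simp add: add_nonneg_pos)
  have t: "0 < t" "t \<le> 1" "t * (norm (y - x) + 1) \<le> e / 2"
  proof -
    show "0 < t" "t \<le> 1" unfolding t_def using e n by auto
    have "t * (norm (y - x) + 1) \<le> e / (2 * (norm (y - x) + 1)) * (norm (y - x) + 1)"
      using n by (intro mult_right_mono) (auto simp: t_def)
    also have "\<dots> = e / 2" using n by (simp add: field_simps)
    finally show "t * (norm (y - x) + 1) \<le> e / 2" .
  qed
  define y' where "y' = y - t *\<^sub>R (y - x)"
  have y': "y' \<in> rel_interior F" unfolding y'_def using rel_interior_convex_shrink[OF cF F(2) y t(1,2)] .
  have y'F: "y' \<in> F" using y' rel_interior_subset by blast
  have dyy': "dist y y' \<le> e / 2"
  proof -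
    have "y - y' = t *\<^sub>R (y - x)" unfolding y'_def by simp
    then have "dist y y' = t * norm (y - x)" using t unfolding dist_norm by simp
    with t show ?thesis by (simp add: distrib_left)
  qed
  \<comment> \<open>Off this closed set every cell contains \<open>y'\<close>, and hence all of
    \<open>F\<close>.\<close>
  define N where "N = \<Union>{P \<in> \<Phi>. y' \<notin> P}"
  have "closed N" unfolding N_def
    using fin polyhedral_complexD(1)[OF pc] by (intro closed_Union) (auto intro: polyhedron_imp_closed)
  moreover have "y' \<notin> N" unfolding N_def by blast
  ultimately obtain d where d: "0 < d" "ball y' d \<subseteq> - N"
    by (meson ComplI openE open_Compl)
  define r where "r = min d (e / 2)"
  have r: "0 < r" "r \<le> d" "r \<le> e / 2" unfolding r_def using d e by auto
  \<comment> \<open>The homothety with centre \<open>z\<close> and ratio \<open>1 - u\<close> takes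
    \<open>y'\<close> to \<open>x\<close>, and it maps every cell containing \<open>F\<close> into
    itself.\<close>
  obtain z u where z: "z \<in> F" "0 < u" "u < 1" "x = (1 - u) *\<^sub>R y' + u *\<^sub>R z"
    using rel_interior_segment_beyond[OF cF F(2) y'F] .
  have "x' \<in> \<Union>\<Phi>" if x': "x' \<in> ball x ((1 - u) * r) \<inter> W" for x'
  proof -
    \<comment> \<open>The displacement of \<open>x'\<close> from \<open>x\<close> is pulled back
      through the homothety to a displacement at \<open>y'\<close>.\<close>
    define h where "h = (1 / (1 - u)) *\<^sub>R (x' - x)"
    have "x \<in> W" "y' \<in> W" using F rel_interior_subset sub y'F by blast+
    then have hW: "h \<in> W" "y' + h \<in> W"
      unfolding h_def using x' W by (auto intro!: subspace_add subspace_scale subspace_diff)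
    have "norm h = norm (x' - x) / (1 - u)" unfolding h_def using z(3) by simp
    also have "\<dots> < r" using x' z(3) by (simp add: dist_norm norm_minus_commute pos_divide_less_eq mult.commute)
    finally have "norm h < r" .
    then have yh: "y' + h \<in> ball y' r" by (simp add: dist_norm)
    have "dist y (y' + h) < e" 
      using dist_triangle[of y "y' + h" y'] dyy' yh r by simp
    with hW e have "y' + h \<in> \<Union>\<Phi>" by auto
    then obtain P where P: "P \<in> \<Phi>" "y' + h \<in> P" by blast
    have "y' \<in> P"
    proof (rule ccontr)
      assume "y' \<notin> P"
      with P have "y' + h \<in> N" unfolding N_def by blast
      moreover have "y' + h \<in> ball y' d" using yh r unfolding mem_ball by linarith
      ultimately show False using d(2) by blast
    qed
    have "(F \<inter> P) face_of F" using polyhedral_complexD(4)[OF pc F(1) P(1)] .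
    from subset_of_face_of[OF this order_refl] have "F \<subseteq> P" using y' y'F \<open>y' \<in> P\<close> by blast
    then have "(1 - u) *\<^sub>R (y' + h) + u *\<^sub>R z \<in> P"
      using z P polyhedral_complexD(2)[OF pc P(1)] by (intro convexD) auto
    moreover have "(1 - u) *\<^sub>R h = x' - x" unfolding h_def using z by simp
    then have "(1 - u) *\<^sub>R (y' + h) + u *\<^sub>R z = x'" 
      unfolding scaleR_add_right using z(4) by (simp add: algebra_simps)
    ultimately show ?thesis using P by auto
  qed
  moreover have "0 < (1 - u) * r" using z r by simp
  ultimately show ?thesis by blast
qed

text \<open>Extrusion starts from the boundary cells only, inside the cones that they span from
  \<open>w\<close>. Since each ray from \<open>w\<close> meets the boundary once, these cones form a
  fan covering \<open>W\<close>.\<close>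

lemma zonotopal_completion_star_shaped_ball:
  fixes W :: "'a::euclidean_space set"
  assumes W: "subspace W" "W \<noteq> {0}" and fin: "finite \<Phi>" and zc: "zonotopal_complex \<Phi>"
    and sub: "\<Union>\<Phi> \<subseteq> W" and star: "star_shaped_ball W (\<Union>\<Phi>)"
  shows "\<exists>\<Psi>. zonotopal_completion W \<Phi> \<Psi> \<and> locally_finite_in (top_of_set W) \<Psi>"
proof -
  define D where "D = \<Union>\<Phi>"
  define Fr where "Fr = (top_of_set W) frontier_of D"
  have pc: "polyhedral_complex \<Phi>" and zon: "\<And>P. P \<in> \<Phi> \<Longrightarrow> zonotope P"
    using zc unfolding zonotopal_complex_def by auto
  note pcD = polyhedral_complexD[OF pc]
  have polyt: "P \<in> \<Phi> \<Longrightarrow> polytope P" for P using zon unfolding zonotope_def by blast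
  have clD: "closed D" unfolding D_def
    using fin pcD(1) by (intro closed_Union) (auto intro: polyhedron_imp_closed)

  \<comment> \<open>The boundary as a union of cells\<close>
  have interior: "x \<in> (top_of_set W) interior_of D \<longleftrightarrow> x \<in> W \<and> (\<exists>e>0. ball x e \<inter> W \<subseteq> D)" for x
  proof
    assume "x \<in> (top_of_set W) interior_of D"
    then obtain T where T: "openin (top_of_set W) T" "x \<in> T" "T \<subseteq> D" unfolding interior_of_def by blast
    then have "T \<subseteq> W" "\<exists>e>0. ball x e \<inter> W \<subseteq> T" unfolding openin_contains_ball by auto
    with T show "x \<in> W \<and> (\<exists>e>0. ball x e \<inter> W \<subseteq> D)" by blast
  next
    assume "x \<in> W \<and> (\<exists>e>0. ball x e \<inter> W \<subseteq> D)"
    then obtain e where e: "x \<in> W" "e > 0" "ball x e \<inter> W \<subseteq> D" by blast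
    moreover have "openin (top_of_set W) (ball x e \<inter> W)" by (auto simp: openin_open)
    ultimately show "x \<in> (top_of_set W) interior_of D" unfolding interior_of_def by auto
  qed
  have "closedin (top_of_set W) D" using clD sub unfolding D_def by (simp add: closed_subset)
  then have Fr_iff: "x \<in> Fr \<longleftrightarrow> x \<in> D \<and> \<not> (\<exists>e>0. ball x e \<inter> W \<subseteq> D)" for x
    unfolding Fr_def frontier_of_def using closure_of_closedin interior[of x] sub D_def by blast
  define B where "B = {F \<in> \<Phi>. F \<subseteq> Fr}"
  \<comment> \<open>If some point of the carrier of \<open>x\<close> were interior to
    \<open>D\<close> relative to \<open>W\<close>, then so would be \<open>x\<close>; hence the
    carrier lies in the boundary.\<close>
  have Fr_cover: "\<exists>F\<in>B. x \<in> F" if x: "x \<in> Fr" for x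
  proof -
    obtain F0 where F0: "F0 \<in> \<Phi>" "x \<in> F0" using x unfolding Fr_iff D_def by blast
    obtain F where F: "F face_of F0" "x \<in> rel_interior F"
      using polyhedron_carrier_face[OF pcD(1)[OF F0(1)] F0(2)] .
    have xF: "x \<in> F" using F(2) rel_interior_subset by blast
    have F\<Phi>: "F \<in> \<Phi>" using pcD(3)[OF F0(1) F(1)] xF by blast
    have "F \<subseteq> Fr"
    proof
      fix y assume y: "y \<in> F"
      have "\<not> (\<exists>e>0. ball y e \<inter> W \<subseteq> D)"
        using interior_point_of_carrier[OF W(1) fin pc sub F\<Phi> F(2) y] x unfolding Fr_iff D_def by blast
      with y F\<Phi> show "y \<in> Fr" unfolding Fr_iff D_def by blast
    qed
    with F\<Phi> xF show ?thesis unfolding B_def by blast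
  qed

  \<comment> \<open>Radial coordinates around the centre\<close>
  obtain w where w: "w \<in> W" and rays: "\<And>u. u \<in> W - {0} \<Longrightarrow>
      \<exists>v. v \<noteq> w \<and> ray w u \<inter> Fr = {v} \<and> D \<inter> ray w u = convex hull {w, v}"
    using star unfolding star_shaped_ball_def Fr_def D_def by blast
  obtain u0 where u0: "u0 \<in> W" "u0 \<noteq> 0" using W subspace_0[OF W(1)] by blast
  have w_ray: "w \<in> ray w u" for u unfolding ray_def by (auto intro!: exI[of _ 0])
  \<comment> \<open>The centre lies on every ray, so as a boundary point it would be the unique one
    there, which is required to differ from \<open>w\<close>.\<close>
  have wFr: "w \<notin> Fr"
  proof -
    obtain v where "v \<noteq> w" "ray w u0 \<inter> Fr = {v}" using rays[of u0] u0 by blast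
    with w_ray[of u0] show ?thesis by (metis IntI singletonD)
  qed
  have FrW: "Fr \<subseteq> W" using sub Fr_iff unfolding D_def by blast
  have g_ray: "ray w (g - w) \<inter> Fr = {g}" "D \<inter> ray w (g - w) = convex hull {w, g}" if g: "g \<in> Fr" for g
  proof -
    have "g - w \<in> W - {0}" using g FrW w wFr W(1) by (auto intro!: subspace_diff)
    then obtain v where v: "ray w (g - w) \<inter> Fr = {v}" "D \<inter> ray w (g - w) = convex hull {w, v}"
      using rays by blast
    moreover have "g \<in> ray w (g - w)" unfolding ray_def by (auto intro!: exI[of _ 1])
    ultimately show "ray w (g - w) \<inter> Fr = {g}" "D \<inter> ray w (g - w) = convex hull {w, g}" using g by auto
  qed
  have uniq: "t = 1" if "g \<in> Fr" "0 \<le> t" "w + t *\<^sub>R (g - w) \<in> Fr" for g t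
  proof -
    have "w + t *\<^sub>R (g - w) = g" using g_ray(1)[OF that(1)] that unfolding ray_def by blast
    then have "(t - 1) *\<^sub>R (g - w) = 0" by (simp add: algebra_simps)
    with that(1) wFr show ?thesis by auto
  qed
  have inD: "w + t *\<^sub>R (g - w) \<in> D \<longleftrightarrow> t \<le> 1" if "g \<in> Fr" "0 \<le> t" for g t
  proof -
    have "w + t *\<^sub>R (g - w) \<in> ray w (g - w)" unfolding ray_def using that by blast
    then have "w + t *\<^sub>R (g - w) \<in> D \<longleftrightarrow> w + t *\<^sub>R (g - w) \<in> closed_segment w g"
      using g_ray(2)[OF that(1)] unfolding segment_convex_hull by blast
    also have "\<dots> \<longleftrightarrow> (\<exists>s. 0 \<le> s \<and> s \<le> 1 \<and> w + t *\<^sub>R (g - w) = w + s *\<^sub>R (g - w))"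
      unfolding closed_segment_def by (auto simp: algebra_simps)
    also have "\<dots> \<longleftrightarrow> t \<le> 1" using that wFr by auto
    finally show ?thesis .
  qed
  have hit: "\<exists>g\<in>Fr. \<exists>t>0. z = w + t *\<^sub>R (g - w)" if z: "z \<in> W" "z \<noteq> w" for z
  proof -
    have "z - w \<in> W - {0}" using z w W(1) by (auto intro!: subspace_diff)
    then obtain v where v: "v \<noteq> w" "ray w (z - w) \<inter> Fr = {v}" using rays by blast
    then obtain t where t: "v = w + t *\<^sub>R (z - w)" "0 \<le> t" unfolding ray_def by blast
    with v have "0 < t" by (cases "t = 0") auto
    then have "0 < 1 / t" "z = w + (1 / t) *\<^sub>R (v - w)" using t by auto
    with v show ?thesis by blast
  qed

  \<comment> \<open>The fan of cones over the boundary cells\<close>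
  define cone where "cone G = {t *\<^sub>R (g - w) | t g. 0 \<le> t \<and> g \<in> G}" for G
  have coneI: "t *\<^sub>R (g - w) \<in> cone G" if "g \<in> G" "0 \<le> t" for t g G
    unfolding cone_def using that by blast
  \<comment> \<open>The point \<open>g\<close> divides the segment with weights
    \<open>a / (a + b)\<close> and \<open>b / (a + b)\<close>. Its position strictly between
    distinct \<open>g1\<close> and \<open>g2\<close> is what the face argument for cones
    uses.\<close>
  have comb: "\<exists>g. g \<in> G \<and> a *\<^sub>R (g1 - w) + b *\<^sub>R (g2 - w) = (a + b) *\<^sub>R (g - w)
      \<and> (g1 \<noteq> g2 \<longrightarrow> g \<in> open_segment g1 g2) \<and> (g1 = g2 \<longrightarrow> g = g1)"
    if "convex G" "g1 \<in> G" "g2 \<in> G" "0 < a" "0 < b" for G g1 g2 a b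
  proof (intro exI conjI impI)
    define s where "s = b / (a + b)"
    have s: "0 < s" "s < 1" "(a + b) * s = b" "(a + b) * (1 - s) = a"
      unfolding s_def using that by (auto simp: field_simps)
    let ?g = "(1 - s) *\<^sub>R g1 + s *\<^sub>R g2"
    show "?g \<in> G" using that s by (intro convexD) auto
    show "?g \<in> open_segment g1 g2" if "g1 \<noteq> g2" using that s unfolding in_segment by auto
    show "?g = g1" if "g1 = g2" using that by (simp add: algebra_simps)
    have "(a + b) *\<^sub>R (?g - w) = ((a + b) * (1 - s)) *\<^sub>R g1 + ((a + b) * s) *\<^sub>R g2 - (a + b) *\<^sub>R w"
      by (simp add: scaleR_add_right scaleR_diff_right)
    also have "\<dots> = a *\<^sub>R (g1 - w) + b *\<^sub>R (g2 - w)" unfolding s(3,4) by (simp add: algebra_simps)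
    finally show "a *\<^sub>R (g1 - w) + b *\<^sub>R (g2 - w) = (a + b) *\<^sub>R (?g - w)" ..
  qed
  have BD: "G \<in> \<Phi>" "convex G" "G \<subseteq> Fr" if "G \<in> B" for G
    using that pcD(2) unfolding B_def by auto
  interpret cone_family W w "cone ` B" \<Phi>
  proof
    show "subspace W" "finite (cone ` B)" using W fin unfolding B_def by auto
  next
    fix C x and t :: real assume "C \<in> cone ` B" "x \<in> C" "0 \<le> t"
    then obtain G a g where "C = cone G" "x = a *\<^sub>R (g - w)" "0 \<le> a" "g \<in> G" unfolding cone_def by blast
    with \<open>0 \<le> t\<close> coneI[of g G "t * a"] show "t *\<^sub>R x \<in> C" by simp
  next
    fix C x y assume "C \<in> cone ` B" "x \<in> C" "y \<in> C"
    then obtain G a1 g1 a2 g2 where G: "G \<in> B" "C = cone G" and x: "x = a1 *\<^sub>R (g1 - w)" "0 \<le> a1" "g1 \<in> G"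
      and y: "y = a2 *\<^sub>R (g2 - w)" "0 \<le> a2" "g2 \<in> G" unfolding cone_def by blast
    show "x + y \<in> C"
    proof (cases "a1 = 0 \<or> a2 = 0")
      case True with G x y \<open>x \<in> C\<close> \<open>y \<in> C\<close> show ?thesis by auto
    next
      case False
      with x y have "0 < a1" "0 < a2" by auto
      from comb[OF BD(2)[OF G(1)] x(3) y(3) this]
      obtain g where "g \<in> G" "x + y = (a1 + a2) *\<^sub>R (g - w)" unfolding x(1) y(1) by blast
      with coneI[of g G "a1 + a2"] x(2) y(2) show ?thesis unfolding G(2) by simp
    qed
  next
    fix C C' x y assume C: "C \<in> cone ` B" "C' \<in> cone ` B" "x \<in> C" "y \<in> C" "x + y \<in> C'"
    then obtain G a1 g1 a2 g2 where G: "G \<in> B" "C = cone G" and x: "x = a1 *\<^sub>R (g1 - w)" "0 \<le> a1" "g1 \<in> G"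
      and y: "y = a2 *\<^sub>R (g2 - w)" "0 \<le> a2" "g2 \<in> G" unfolding cone_def by blast
    from C obtain H c h where H: "H \<in> B" "C' = cone H" and h: "x + y = c *\<^sub>R (h - w)" "0 \<le> c" "h \<in> H"
      unfolding cone_def by blast
    have "0 \<in> C'" unfolding H using coneI[OF h(3), of 0] by simp
    show "x \<in> C' \<and> y \<in> C'"
    proof (cases "a1 = 0 \<or> a2 = 0")
      case True with x y \<open>0 \<in> C'\<close> C(5) show ?thesis by auto
    next
      case False
      with x y have a: "0 < a1" "0 < a2" by auto
      obtain g where g: "g \<in> G" "x + y = (a1 + a2) *\<^sub>R (g - w)" "g1 \<noteq> g2 \<Longrightarrow> g \<in> open_segment g1 g2"
        "g1 = g2 \<Longrightarrow> g = g1"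
        using comb[OF BD(2)[OF G(1)] x(3) y(3) a] unfolding x y by blast
      \<comment> \<open>Now \<open>g\<close> and \<open>h\<close> are boundary points on the same
        ray and therefore coincide, so the fan inherits its face property from the face
        \<open>G \<inter> H\<close> of \<open>G\<close>.\<close>
      have "g - w = (1 / (a1 + a2)) *\<^sub>R ((a1 + a2) *\<^sub>R (g - w))" using a by simp
      also have "\<dots> = (c / (a1 + a2)) *\<^sub>R (h - w)" unfolding g(2)[symmetric] h(1) by simp
      finally have geq: "g = w + (c / (a1 + a2)) *\<^sub>R (h - w)" by (simp add: algebra_simps)
      have "h \<in> Fr" "g \<in> Fr" using BD(3) H h G g by blast+
      with uniq[of h "c / (a1 + a2)"] geq h(2) a have "g = h" by auto
      then have gHG: "g \<in> G \<inter> H" using g h by blast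
      have "(G \<inter> H) face_of G" using pcD(4) BD(1) G H by blast
      have "g1 \<in> H \<and> g2 \<in> H"
      proof (cases "g1 = g2")
        case True with g gHG show ?thesis by auto
      next
        case False
        with face_ofD[OF \<open>(G \<inter> H) face_of G\<close> g(3) x(3) y(3) gHG] show ?thesis by auto
      qed
      with x y H coneI show ?thesis by auto
    qed
  qed
  have cone_at_iff: "x \<in> cone_at (cone G) \<longleftrightarrow> (\<exists>t g. 0 \<le> t \<and> g \<in> G \<and> x = w + t *\<^sub>R (g - w))" for x G
    unfolding cone_at_def cone_def by (auto simp: algebra_simps)
  have cone_atI: "w + t *\<^sub>R (g - w) \<in> cone_at (cone G)" if "g \<in> G" "0 \<le> t" for t g G
    unfolding cone_at_iff using that by blast

  \<comment> \<open>The boundary cells as starting cells\<close>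
  have ext: "extendable B"
    unfolding extendable_def
  proof (intro conjI)
    have eq: "\<Phi> \<union> B = \<Phi>" unfolding B_def by blast
    show "zonotopal_complex (\<Phi> \<union> B)" "\<Union>(\<Phi> \<union> B) \<subseteq> W" "\<forall>r. finite {F \<in> \<Phi> \<union> B. F \<inter> cball 0 r \<noteq> {}}"
      unfolding eq using zc sub fin by auto
    show "\<forall>F\<in>B. \<forall>G. G face_of F \<and> G \<noteq> {} \<longrightarrow> G \<in> B"
      unfolding B_def using pcD(3) face_of_imp_subset by blast
    have "(F \<inter> cone_at (cone G)) face_of F" if FG: "F \<in> B" "G \<in> B" for F G
    proof -
      \<comment> \<open>A boundary point in the cone over \<open>G\<close> already lies in
        \<open>G\<close>, as its ray meets the boundary only once.\<close>
      have "F \<inter> cone_at (cone G) = F \<inter> G"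
      proof (intro equalityI subsetI)
        fix x assume x: "x \<in> F \<inter> cone_at (cone G)"
        then have "x \<in> cone_at (cone G)" by simp
        then obtain t g where "0 \<le> t" "g \<in> G" "x = w + t *\<^sub>R (g - w)" unfolding cone_at_iff by blast
        moreover from this have "t = 1" using uniq[of g t] x BD(3) FG by blast
        ultimately show "x \<in> F \<inter> G" using x by simp
      next
        fix x assume "x \<in> F \<inter> G"
        with cone_atI[of x G 1] show "x \<in> F \<inter> cone_at (cone G)" by auto
      qed
      with pcD(4) BD(1) FG show ?thesis by simp
    qed
    then show "\<forall>F\<in>B. \<forall>C\<in>cone ` B. (F \<inter> cone_at C) face_of F" by blast
    have "polyhedral (D \<inter> cone_at (cone G))" if G: "G \<in> B" for G
    proof (cases "G = {}")
      case True
      then have "cone_at (cone G) = {}" unfolding cone_at_iff[abs_def] set_eq_iff cone_at_iff by blast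
      then show ?thesis using polyhedron_imp_polyhedral[OF polyhedron_empty] by simp
    next
      case False
      \<comment> \<open>In radial coordinates \<open>D\<close> is given by \<open>t \<le> 1\<close>,
        so its part in the cone is the pyramid with apex \<open>w\<close> over \<open>G\<close>,
        however the cells of \<open>\<Phi>\<close> cross the cone.\<close>
      have "D \<inter> cone_at (cone G) = convex hull (insert w G)"
      proof (intro set_eqI iffI)
        fix x assume "x \<in> D \<inter> cone_at (cone G)"
        then have "x \<in> cone_at (cone G)" "x \<in> D" by simp_all
        then obtain t g where tg: "0 \<le> t" "g \<in> G" "x = w + t *\<^sub>R (g - w)" "x \<in> D" unfolding cone_at_iff by blast
        then have "t \<le> 1" using inD BD(3)[OF G] by blast
        moreover have "x = (1 - t) *\<^sub>R w + t *\<^sub>R g" using tg(3) by (simp add: algebra_simps)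
        ultimately show "x \<in> convex hull (insert w G)"
          using tg by (auto intro!: convexD[OF convex_convex_hull] simp: hull_inc)
      next
        fix x assume "x \<in> convex hull (insert w G)"
        then obtain a t g where "0 \<le> a" "0 \<le> t" "a + t = 1" and g: "g \<in> G" "x = a *\<^sub>R w + t *\<^sub>R g"
          unfolding convex_hull_insert[OF False] hull_same[of convex, OF BD(2)[OF G]] by blast
        then have t: "0 \<le> t" "t \<le> 1" "a = 1 - t" by auto
        have x: "x = w + t *\<^sub>R (g - w)" unfolding g(2) t(3) by (simp add: algebra_simps)
        show "x \<in> D \<inter> cone_at (cone G)"
          unfolding x using inD[of g t] cone_atI[OF g(1) t(1)] t BD(3)[OF G] g(1) by blast
      qed
      moreover obtain S where S: "finite S" "G = convex hull S"
        using polyt[OF BD(1)[OF G]] unfolding polytope_def by blast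
      then have "polytope (convex hull (insert w G))"
        by (metis polytope_convex_hull finite_insert hull_insert)
      ultimately show ?thesis by (simp add: polytope_imp_polyhedron polyhedron_imp_polyhedral)
    qed
    then show "\<forall>C\<in>cone ` B. polyhedral (\<Union>(\<Phi> \<union> B) \<inter> cone_at C)" unfolding eq D_def by blast
    have "\<exists>s>0. x + s *\<^sub>R v \<in> D" if x: "x \<in> D" "x \<notin> \<Union>B" and v: "v \<in> W" for x v
    proof -
      have "x \<notin> Fr" using x(2) Fr_cover by blast
      then obtain e where e: "e > 0" "ball x e \<inter> W \<subseteq> D" using x(1) unfolding Fr_iff by blast
      define s where "s = e / (norm v + 1)"
      have n: "0 < norm v + 1" by (simp add: add_nonneg_pos)
      have s: "s > 0" unfolding s_def using e n by simp
      have "s * norm v < e" using e n unfolding s_def by (simp add: field_simps)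
      then have "x + s *\<^sub>R v \<in> ball x e" using s by (simp add: dist_norm)
      moreover have "x + s *\<^sub>R v \<in> W" using x(1) sub v W(1) unfolding D_def
        by (intro subspace_add subspace_scale) auto
      ultimately show ?thesis using e s by blast
    qed
    then show "\<forall>x\<in>\<Union>(\<Phi> \<union> B) - \<Union>B. \<forall>v\<in>W. \<exists>s>0. x + s *\<^sub>R v \<in> \<Union>(\<Phi> \<union> B)"
      unfolding eq D_def by blast
  qed

  \<comment> \<open>Directions that span each cone positively\<close>
  have "\<exists>S. finite S \<and> G = convex hull S" if "G \<in> B" for G
    using polyt[OF BD(1)[OF that]] unfolding polytope_def .
  then obtain S where S: "\<And>G. G \<in> B \<Longrightarrow> finite (S G) \<and> G = convex hull (S G)" by metis
  have SG: "S G \<subseteq> G" if "G \<in> B" for G using S[OF that] hull_subset[of "S G" convex] by auto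
  define V where "V = (\<Union>G\<in>B. (\<lambda>s. s - w) ` S G)"
  have V: "finite V" "V \<subseteq> W"
  proof -
    show "finite V" unfolding V_def using fin S unfolding B_def by auto
    show "V \<subseteq> W" unfolding V_def using SG BD(3) FrW w W(1) by (fastforce intro!: subspace_diff)
  qed
  show ?thesis
  proof (rule extendable_completion[OF ext pc V])
    fix z assume z: "z \<in> W"
    have "\<exists>g\<in>Fr. \<exists>t\<ge>0. z = w + t *\<^sub>R (g - w)"
    proof (cases "z = w")
      case True
      from hit[of "w + u0"] u0 w W(1) obtain g where "g \<in> Fr" by (auto simp: subspace_add)
      with True show ?thesis by (intro bexI[of _ g] exI[of _ 0]) auto
    next
      case False with hit[OF z] show ?thesis by (meson less_imp_le)
    qed
    then obtain g t G where g: "0 \<le> t" "z = w + t *\<^sub>R (g - w)" "g \<in> Fr" "G \<in> B" "g \<in> G"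
      using Fr_cover by blast
    have finS: "finite (S G)" using S g(4) by blast
    have "g \<in> convex hull (S G)" using S g(4,5) by blast
    then obtain u where u: "\<forall>s\<in>S G. 0 \<le> u s" "sum u (S G) = 1" "g = (\<Sum>s\<in>S G. u s *\<^sub>R s)"
      unfolding convex_hull_finite[OF finS] by blast
    \<comment> \<open>Convex coordinates of \<open>g\<close> in \<open>S G\<close>, scaled by
      \<open>t\<close>, become coefficients of the directions from \<open>w\<close>. Directions in
      the cone that come only from other cells get coefficient \<open>0\<close>.\<close>
    define c where "c v = (if v + w \<in> S G then t * u (v + w) else 0)" for v
    have sub': "(\<lambda>s. s - w) ` S G \<subseteq> V \<inter> cone G"
      unfolding V_def using g(4) SG[OF g(4)] coneI[of _ G 1] by auto
    have "(\<Sum>v\<in>V \<inter> cone G. c v *\<^sub>R v) = (\<Sum>v\<in>(\<lambda>s. s - w) ` S G. c v *\<^sub>R v)"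
    proof (rule sum.mono_neutral_right[OF _ sub'])
      show "finite (V \<inter> cone G)" using V by simp
      have "v + w \<notin> S G" if "v \<notin> (\<lambda>s. s - w) ` S G" for v
        using that by (metis add_diff_cancel_right' image_eqI)
      then show "\<forall>v\<in>V \<inter> cone G - (\<lambda>s. s - w) ` S G. c v *\<^sub>R v = 0" unfolding c_def by auto
    qed
    also have "\<dots> = (\<Sum>s\<in>S G. (t * u s) *\<^sub>R (s - w))"
      by (subst sum.reindex) (auto simp: c_def inj_on_def intro!: sum.cong)
    also have "\<dots> = t *\<^sub>R ((\<Sum>s\<in>S G. u s *\<^sub>R s) - (\<Sum>s\<in>S G. u s) *\<^sub>R w)"
      by (simp add: scaleR_sum_right scaleR_sum_left scaleR_diff_right sum_subtractf)
    also have "\<dots> = t *\<^sub>R (g - w)" using u by simp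
    finally have "z = w + (\<Sum>v\<in>V \<inter> cone G. c v *\<^sub>R v)" using g(2) by simp
    moreover have "\<forall>v\<in>V \<inter> cone G. 0 \<le> c v" unfolding c_def using u(1) g(1) by auto
    moreover have "w \<in> \<Union>(\<Phi> \<union> B) \<inter> cone_at (cone G)"
      using inD[OF g(3), of 0] cone_atI[OF g(5), of 0] unfolding D_def by auto
    ultimately show "\<exists>C\<in>cone ` B. \<exists>x c. x \<in> \<Union>(\<Phi> \<union> B) \<inter> cone_at C \<and> (\<forall>v\<in>V \<inter> C. 0 \<le> c v)
      \<and> z = x + (\<Sum>v\<in>V \<inter> C. c v *\<^sub>R v)"
      using g(4) by blast
  qed
qed

theorem theorem1p4:
  fixes W :: "'a::euclidean_space set" and \<Phi> :: "'a set set"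
  assumes "subspace W"
    and "finite \<Phi>" and "zonotopal_complex \<Phi>" and "\<Union>\<Phi> \<subseteq> W"
    and "polytope (\<Union>\<Phi>) \<or> star_shaped_ball W (\<Union>\<Phi>)"
  shows "\<exists>\<Psi>. zonotopal_completion W \<Phi> \<Psi> \<and> locally_finite_in (top_of_set W) \<Psi>"
proof (cases "polytope (\<Union>\<Phi>)")
  case True
  with zonotopal_completion_polytope assms show ?thesis by blast
next
  case False
  \<comment> \<open>In dimension zero the union is a polytope in any event, so
    \<open>W \<noteq> {0}\<close> holds in the remaining case.\<close>
  have "\<Union>\<Phi> = {} \<or> \<Union>\<Phi> = {0}" if "W = {0}" using assms(4) that by blast
  with False polytope_sing[of "0::'a"] polytope_empty have "W \<noteq> {0}" by metis
  with False zonotopal_completion_star_shaped_ball assms show ?thesis by blast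
qed

end
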